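(* Let $M$ be a complex manifold and let $\widehat{\mathbb N}=\mathbb N\cup\{\infty\}$, $M'=\widehat{\mathbb N}\times M$. For every $n\in\widehat{\mathbb N}$ let $\mathscr F_n=\{f_{n,\lambda}:\lambda\in M\}\subset \mathrm{Hol}^*_b(\mathbb C)$ be a family of entire functions parametrized by $M$. Assume that the map $F:M'\to\mathrm{Hol}^*_b(\mathbb C)$, $(n,\lambda)\mapsto f_{n,\lambda}$, is continuous with respect to the metrics $\chi_{M'}$ and $\chi_{\mathrm{dyn}}$. Let $H_\infty$ be a connected component of $\mathcal H(\mathscr F_\infty)$. Then there exists a kernel $\widetilde H$ of a sequence of connected components of $\mathcal H(\mathscr F_n)$ such that $H_\infty\subset\widetilde H$.
   Context: $\mathrm{Hol}^*(\mathbb C)$ is the set of entire functions that are neither constant nor linear (i.e. polynomials of degree $\ge 2$ and transcendental entire functions). The set $S(f)$ of singular values of $f$ is the smallest closed set in $\mathbb C$ such that $f:\mathbb C\setminus f^{-1}(S(f))\to\mathbb C\setminus S(f)$ is a covering map (equivalently, the closure of the set of critical values and finite asymptotic values). $\mathrm{Hol}^*_b(\mathbb C)=\{f\in\mathrm{Hol}^*(\mathbb C): S(f)\text{ is bounded}\}$. $P(f)=\overline{\bigcup_{n\ge0}f^n(S(f))}$ (closure in $\mathbb C$). The Fatou set $\mathcal F(f)\subset\mathbb C$ is the set of points having a neighbourhood on which the iterates $(f^n)_{n\in\mathbb N}$ form a normal family in the sense of Montel. A map $f\in\mathrm{Hol}^*(\mathbb C)$ is nonescaping-hyperbolic if $P(f)$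 is a bounded subset of $\mathcal F(f)$. Metric: $\chi_{\mathrm{dyn}}(f,g)=\chi_{\mathrm{luc}}(f,g)+d_H(S(f),S(g))$ on $\mathrm{Hol}^*(\mathbb C)$, where $\chi_{\mathrm{luc}}$ is the locally uniform distance, a metric on the space of entire functions inducing the topology of locally uniform convergence, and $d_H(A,B)=\inf\{\varepsilon>0: A\subset U_\varepsilon(B),\ B\subset U_\varepsilon(A)\}$ is the Hausdorff distance, measured with respect to the spherical metric, $U_\varepsilon$ denoting $\varepsilon$-neighbourhoods. On $\widehat{\mathbb N}$ put $\chi_{\widehat{\mathbb N}}(m,n)=2^{-\min(m,n)-1}$ for $m\ne n$ and $0$ otherwise. $M$ carries a metric $\chi_M$ (inducing its topology), and $\chi_{M'}((m,\lambda),(n,\nu))=\chi_{\widehat{\mathbb N}}(m,n)+\chi_M(\lambda,\nu)$. For $n\in\widehat{\mathbb N}$, $\mathcal H(\mathscr F_n)=\{\lambda\in M: f_{n,\lambda}\text{ is nonescaping-hyperbolic}\}$. Kernel: let $o\in M$ and let $O_n\subset M$, $n\in\mathbb N$, be open connected sets containing $o$. The kernel of the sequence $(O_n)$ with respect to the marked point $o$ is the largest open connected set $O\ni o$ such that each compact set $K\subset O$ is contained in all but finitely many $O_n$ (its existence is equivalent to the existence of a neighbourhood of $o$ contained in all but finitely many $O_n$). A sequence can have more than one kernel, each specified by the choice of a marked point; a kernel of $(O_n)$ means a kernel with respect to some marked point. *)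

theory Defs
  imports "HOL-Complex_Analysis.Complex_Analysis" "HOL-Library.Extended_Nat"
begin

section \<open>Complex manifolds\<close>

text \<open>The model space is the coordinate subspace of \<open>complex^'d\<close> spanned by the coordinates in
  \<open>I\<close>, a copy of complex \<open>card I\<close>-space. Index types are nonempty, so allowing \<open>I = {}\<close> is what
  makes zero-dimensional manifolds available.\<close>

definition model_space :: "'d::finite set \<Rightarrow> (complex^'d) set" where
  "model_space I = {v. \<forall>i. i \<notin> I \<longrightarrow> v $ i = 0}"

definition holomorphic_map_on ::
    "(complex^'d::finite \<Rightarrow> complex^'e::finite) \<Rightarrow> (complex^'d) set \<Rightarrow> bool" where
  "holomorphic_map_on g S \<longleftrightarrow>
     (\<forall>x\<in>S. \<exists>D. (g has_derivative D) (at x within S) \<and> (\<forall>c v. D (c *s v) = c *s D v))"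

text \<open>The carrier of the manifold is the whole type. It is used below at a type of class
  \<^class>\<open>metric_space\<close>, so that it is Hausdorff and paracompact.\<close>

definition complex_atlas ::
    "'d::finite set \<Rightarrow> ('m::topological_space set \<times> ('m \<Rightarrow> complex^'d)) set \<Rightarrow> bool" where
  "complex_atlas I \<A> \<longleftrightarrow>
     (\<Union>(U, \<phi>)\<in>\<A>. U) = UNIV \<and>
     (\<forall>(U, \<phi>)\<in>\<A>. open U \<and> openin (top_of_set (model_space I)) (\<phi> ` U) \<and>
        (\<exists>\<psi>. homeomorphism U (\<phi> ` U) \<phi> \<psi>)) \<and>
     (\<forall>(U, \<phi>)\<in>\<A>. \<forall>(V, \<psi>)\<in>\<A>.
        holomorphic_map_on (\<psi> \<circ> inv_into U \<phi>) (\<phi> ` (U \<inter> V)))"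


section \<open>Entire functions, singular values, hyperbolicity\<close>

definition entire :: "(complex \<Rightarrow> complex) set" where
  "entire = {f. f holomorphic_on UNIV}"

definition Hol_star :: "(complex \<Rightarrow> complex) set" where
  "Hol_star = {f \<in> entire. \<not> (\<exists>a b. \<forall>z. f z = a * z + b)}"

definition singular_set :: "(complex \<Rightarrow> complex) \<Rightarrow> complex set" where
  "singular_set f = (LEAST S. closed S \<and> covering_space (UNIV - f -` S) f (UNIV - S))"

definition Hol_star_b :: "(complex \<Rightarrow> complex) set" where
  "Hol_star_b = {f \<in> Hol_star. bounded (singular_set f)}"

definition postsingular_set :: "(complex \<Rightarrow> complex) \<Rightarrow> complex set" where
  "postsingular_set f = closure (\<Union>n. (f ^^ n) ` singular_set f)"

text \<open>Montel normality of a family on a domain \<open>U\<close>, with values in the Riemann sphere: on a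
  connected set, a locally uniform spherical limit of holomorphic functions is either holomorphic
  or constantly infinity.\<close>

definition normal_family :: "complex set \<Rightarrow> (complex \<Rightarrow> complex) set \<Rightarrow> bool" where
  "normal_family U \<F> \<longleftrightarrow>
     (\<forall>s :: nat \<Rightarrow> complex \<Rightarrow> complex. range s \<subseteq> \<F> \<longrightarrow>
       (\<exists>r :: nat \<Rightarrow> nat. strict_mono r \<and>
         ((\<exists>h. h holomorphic_on U \<and>
             (\<forall>K. compact K \<and> K \<subseteq> U \<longrightarrow> uniform_limit K (\<lambda>n. s (r n)) h sequentially)) \<or>
          (\<forall>K. compact K \<and> K \<subseteq> U \<longrightarrow>
             (\<forall>B. \<forall>\<^sub>F n in sequentially. \<forall>z\<in>K. norm (s (r n) z) > B)))))"

definition Fatou_set :: "(complex \<Rightarrow> complex) \<Rightarrow> complex set" where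
  "Fatou_set f =
     {z. \<exists>U. open U \<and> connected U \<and> z \<in> U \<and> normal_family U (range (\<lambda>n. f ^^ n))}"

definition nonescaping_hyperbolic :: "(complex \<Rightarrow> complex) \<Rightarrow> bool" where
  "nonescaping_hyperbolic f \<longleftrightarrow>
     f \<in> Hol_star \<and> bounded (postsingular_set f) \<and> postsingular_set f \<subseteq> Fatou_set f"

definition hyperbolic_locus :: "('m \<Rightarrow> complex \<Rightarrow> complex) \<Rightarrow> 'm set" where
  "hyperbolic_locus F = {l. nonescaping_hyperbolic (F l)}"

text \<open>The smallest closed set in the definition of \<^const>\<open>singular_set\<close> exists: it is the
  complement of the set of evenly covered points.\<close>

lemma singular_set_least:
  assumes "f \<in> Hol_star"
  shows "closed (singular_set f)"
    and "covering_space (UNIV - f -` singular_set f) f (UNIV - singular_set f)"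
    and "\<And>S. \<lbrakk>closed S; covering_space (UNIV - f -` S) f (UNIV - S)\<rbrakk> \<Longrightarrow> singular_set f \<subseteq> S"
proof -
  have hol: "f holomorphic_on UNIV" and nlin: "\<not> (\<exists>a b. \<forall>z. f z = a * z + b)"
    using assms by (auto simp: Hol_star_def entire_def)
  have nconst: "\<And>c. f \<noteq> (\<lambda>x. c)"
    using nlin by (metis add_0 mult_zero_left)
  have cont: "continuous_on A f" for A
    using hol holomorphic_on_imp_continuous_on continuous_on_subset by blast
  define ev where "ev T \<longleftrightarrow> open T \<and> (\<exists>v. \<Union>v = f -` T \<and> (\<forall>u\<in>v. open u) \<and>
      pairwise disjnt v \<and> (\<forall>u\<in>v. \<exists>q. homeomorphism u T f q))" for T
  define U where "U = \<Union>{T. ev T}"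
  let ?P = "\<lambda>S. closed S \<and> covering_space (UNIV - f -` S) f (UNIV - S)"
  have opU: "open U"
    unfolding U_def ev_def by (rule open_Union) auto
  have opfU: "open (f -` U)"
    by (rule open_vimage[OF opU cont])
  have hit: "T \<subseteq> range f" if evT: "ev T" for T
  proof (cases "T = {}")
    case False
    then obtain a where a: "a \<in> T" by blast
    have "open T" using evT by (simp add: ev_def)
    then have "\<not> T \<subseteq> {a}"
      using a by (metis not_open_singleton subset_singletonD empty_iff)
    then obtain b where b: "b \<in> T" "a \<noteq> b" by blast
    have "range f \<inter> {a, b} \<noteq> {}"
      using little_Picard[OF hol b(2)] nconst by metis
    then obtain z where z: "f z \<in> T" using a b by auto
    obtain v where v: "\<Union>v = f -` T" "\<forall>u\<in>v. \<exists>q. homeomorphism u T f q"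
      using evT unfolding ev_def by (elim exE conjE)
    have "z \<in> \<Union>v" using z v(1) by simp
    then obtain u where "u \<in> v" by blast
    then obtain q where "homeomorphism u T f q" using v(2) by blast
    then have "f ` u = T" by (rule homeomorphism_image1)
    then show ?thesis by (metis image_mono subset_UNIV)
  qed auto
  have PU: "?P (- U)"
  proof
    show "closed (- U)" using opU by (simp add: closed_Compl)
    have eq: "UNIV - f -` (- U) = f -` U" "UNIV - (- U) = U" by auto
    have "covering_space (f -` U) f U"
      unfolding covering_space_def
    proof (intro conjI ballI)
      show "continuous_on (f -` U) f" by (rule cont)
      have "U \<subseteq> range f" unfolding U_def using hit by (simp add: Sup_le_iff)
      then show "f ` (f -` U) = U" by (simp add: image_vimage_eq inf.absorb1)
      fix x assume "x \<in> U"
      then obtain T where T: "x \<in> T" "ev T" by (auto simp: U_def)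
      have TU: "T \<subseteq> U" using T(2) by (auto simp: U_def)
      obtain v where v: "\<Union>v = f -` T" "\<forall>u\<in>v. open u" "pairwise disjnt v"
          "\<forall>u\<in>v. \<exists>q. homeomorphism u T f q"
        using T(2) unfolding ev_def by (elim exE conjE)
      have "openin (top_of_set U) T"
        using T(2) TU by (simp add: ev_def openin_open_eq[OF opU])
      moreover have "\<Union>v = f -` U \<inter> f -` T" using v(1) TU by auto
      moreover have "\<forall>u\<in>v. openin (top_of_set (f -` U)) u"
        using v(1,2) TU by (simp add: openin_open_eq[OF opfU]) blast
      ultimately show "\<exists>T. x \<in> T \<and> openin (top_of_set U) T \<and>
          (\<exists>v. \<Union>v = f -` U \<inter> f -` T \<and> (\<forall>u\<in>v. openin (top_of_set (f -` U)) u) \<and>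
            pairwise disjnt v \<and> (\<forall>u\<in>v. \<exists>q. homeomorphism u T f q))"
        using T(1) v(3,4) by (intro exI[of _ T] exI[of _ v] conjI)
    qed
    then show "covering_space (UNIV - f -` (- U)) f (UNIV - (- U))"
      by (simp only: eq)
  qed
  have least: "- U \<subseteq> S" if S: "?P S" for S
  proof -
    have opS: "open (UNIV - S)" using S by (simp add: open_Diff)
    have "UNIV - f -` S = f -` (UNIV - S)" by auto
    then have opfS: "open (UNIV - f -` S)"
      using open_vimage[OF opS cont] by simp
    have "x \<in> U" if x: "x \<in> UNIV - S" for x
    proof -
      have cov: "covering_space (UNIV - f -` S) f (UNIV - S)" using S by simp
      obtain T v where T: "x \<in> T" "openin (top_of_set (UNIV - S)) T"
          and v: "\<Union>v = (UNIV - f -` S) \<inter> f -` T"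
          "\<forall>u\<in>v. openin (top_of_set (UNIV - f -` S)) u" "pairwise disjnt v"
          "\<forall>u\<in>v. \<exists>q. homeomorphism u T f q"
        using bspec[OF conjunct2[OF conjunct2[OF cov[unfolded covering_space_def]]] x]
        by (elim exE conjE)
      have "open T" "T \<subseteq> UNIV - S" using T(2) by (simp_all only: openin_open_eq[OF opS])
      moreover have "\<Union>v = f -` T" using v(1) \<open>T \<subseteq> UNIV - S\<close> by auto
      moreover have "\<forall>u\<in>v. open u" using v(2) by (simp only: openin_open_eq[OF opfS]) simp
      ultimately have "ev T" using v(3,4) unfolding ev_def by (intro conjI exI[of _ v])
      then show ?thesis using T(1) by (auto simp: U_def)
    qed
    then show ?thesis by auto
  qed
  have eq: "singular_set f = - U"
    unfolding singular_set_def by (rule Least_equality[where P = ?P, OF PU least])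
  show "closed (singular_set f)"
    "covering_space (UNIV - f -` singular_set f) f (UNIV - singular_set f)"
    unfolding eq using PU by (rule conjunct1, rule conjunct2)
  show "\<And>S. \<lbrakk>closed S; covering_space (UNIV - f -` S) f (UNIV - S)\<rbrakk> \<Longrightarrow> singular_set f \<subseteq> S"
    unfolding eq by (rule least) (rule conjI)
qed


section \<open>Metrics\<close>

definition luc_topology :: "(complex \<Rightarrow> complex) topology" where
  "luc_topology = topology (\<lambda>\<U>. \<U> \<subseteq> entire \<and>
     (\<forall>f\<in>\<U>. \<exists>K \<epsilon>. compact K \<and> \<epsilon> > 0 \<and>
        {g \<in> entire. \<forall>z\<in>K. dist (g z) (f z) < \<epsilon>} \<subseteq> \<U>))"

lemma openin_luc_topology:
  "openin luc_topology \<U> \<longleftrightarrow> \<U> \<subseteq> entire \<and>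
     (\<forall>f\<in>\<U>. \<exists>K \<epsilon>. compact K \<and> \<epsilon> > 0 \<and>
        {g \<in> entire. \<forall>z\<in>K. dist (g z) (f z) < \<epsilon>} \<subseteq> \<U>)"
proof -
  let ?L = "\<lambda>\<U>. \<U> \<subseteq> entire \<and>
     (\<forall>f\<in>\<U>. \<exists>K \<epsilon>. compact K \<and> (\<epsilon>::real) > 0 \<and>
        {g \<in> entire. \<forall>z\<in>K. dist (g z) (f z) < \<epsilon>} \<subseteq> \<U>)"
  have "istopology ?L"
    unfolding istopology_def
  proof (intro conjI allI impI)
    fix S T assume S: "?L S" and T: "?L T"
    show "S \<inter> T \<subseteq> entire" using S by auto
    show "\<forall>f\<in>S \<inter> T. \<exists>K \<epsilon>. compact K \<and> (\<epsilon>::real) > 0 \<and>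
        {g \<in> entire. \<forall>z\<in>K. dist (g z) (f z) < \<epsilon>} \<subseteq> S \<inter> T"
    proof
      fix f assume "f \<in> S \<inter> T"
      then have f: "f \<in> S" "f \<in> T" by auto
      obtain K1 e1 where 1: "compact K1" "(e1::real) > 0"
          "{g \<in> entire. \<forall>z\<in>K1. dist (g z) (f z) < e1} \<subseteq> S"
        using bspec[OF conjunct2[OF S] f(1)] by (elim exE conjE)
      obtain K2 e2 where 2: "compact K2" "(e2::real) > 0"
          "{g \<in> entire. \<forall>z\<in>K2. dist (g z) (f z) < e2} \<subseteq> T"
        using bspec[OF conjunct2[OF T] f(2)] by (elim exE conjE)
      have "compact (K1 \<union> K2)" "min e1 e2 > 0" using 1 2 by (auto intro: compact_Un)
      moreover have "{g \<in> entire. \<forall>z\<in>K1 \<union> K2. dist (g z) (f z) < min e1 e2}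
          \<subseteq> {g \<in> entire. \<forall>z\<in>K1. dist (g z) (f z) < e1} \<inter>
             {g \<in> entire. \<forall>z\<in>K2. dist (g z) (f z) < e2}"
        by auto
      then have "{g \<in> entire. \<forall>z\<in>K1 \<union> K2. dist (g z) (f z) < min e1 e2} \<subseteq> S \<inter> T"
        using 1(3) 2(3) by (meson Int_mono order_trans)
      ultimately show "\<exists>K \<epsilon>. compact K \<and> (\<epsilon>::real) > 0 \<and>
          {g \<in> entire. \<forall>z\<in>K. dist (g z) (f z) < \<epsilon>} \<subseteq> S \<inter> T"
        by (intro exI conjI)
    qed
  next
    fix \<K> assume K: "\<forall>S\<in>\<K>. ?L S"
    show "\<Union>\<K> \<subseteq> entire" using K by blast
    show "\<forall>f\<in>\<Union>\<K>. \<exists>K \<epsilon>. compact K \<and> (\<epsilon>::real) > 0 \<and>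
        {g \<in> entire. \<forall>z\<in>K. dist (g z) (f z) < \<epsilon>} \<subseteq> \<Union>\<K>"
    proof
      fix f assume "f \<in> \<Union>\<K>"
      then obtain S where S: "f \<in> S" "S \<in> \<K>" by blast
      obtain K e where 1: "compact K" "(e::real) > 0"
          "{g \<in> entire. \<forall>z\<in>K. dist (g z) (f z) < e} \<subseteq> S"
        using bspec[OF conjunct2[OF bspec[OF K S(2)]] S(1)] by (elim exE conjE)
      have "{g \<in> entire. \<forall>z\<in>K. dist (g z) (f z) < e} \<subseteq> \<Union>\<K>"
        using 1(3) Union_upper[OF S(2)] by (rule order_trans)
      then show "\<exists>K \<epsilon>. compact K \<and> (\<epsilon>::real) > 0 \<and>
          {g \<in> entire. \<forall>z\<in>K. dist (g z) (f z) < \<epsilon>} \<subseteq> \<Union>\<K>"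
        using 1(1,2) by (intro exI conjI)
    qed
  qed
  then show ?thesis
    unfolding luc_topology_def by (rule fun_cong[OF topology_inverse'])
qed

definition locally_uniform_metric ::
    "((complex \<Rightarrow> complex) \<Rightarrow> (complex \<Rightarrow> complex) \<Rightarrow> real) \<Rightarrow> bool" where
  "locally_uniform_metric d \<longleftrightarrow>
     Metric_space entire d \<and> Metric_space.mtopology entire d = luc_topology"

text \<open>Geodesic distance for the metric \<open>2|dz| / (1 + |z|\<^sup>2)\<close>; the quotient is half the chordal
  distance on the unit sphere.\<close>

definition spherical_dist :: "complex \<Rightarrow> complex \<Rightarrow> real" where
  "spherical_dist z w =
     2 * arcsin (norm (z - w) / (sqrt (1 + (norm z)\<^sup>2) * sqrt (1 + (norm w)\<^sup>2)))"

definition spherical_nbhd :: "real \<Rightarrow> complex set \<Rightarrow> complex set" where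
  "spherical_nbhd \<epsilon> A = {z. \<exists>w\<in>A. spherical_dist z w < \<epsilon>}"

definition hausdorff_dist :: "complex set \<Rightarrow> complex set \<Rightarrow> real" where
  "hausdorff_dist A B =
     Inf {\<epsilon>. \<epsilon> > 0 \<and> A \<subseteq> spherical_nbhd \<epsilon> B \<and> B \<subseteq> spherical_nbhd \<epsilon> A}"

definition chi_dyn ::
    "((complex \<Rightarrow> complex) \<Rightarrow> (complex \<Rightarrow> complex) \<Rightarrow> real) \<Rightarrow>
     (complex \<Rightarrow> complex) \<Rightarrow> (complex \<Rightarrow> complex) \<Rightarrow> real" where
  "chi_dyn chi_luc f g = chi_luc f g + hausdorff_dist (singular_set f) (singular_set g)"

text \<open>For \<open>m \<noteq> n\<close> the minimum is finite, so \<^const>\<open>the_enat\<close> is only applied to finite values.\<close>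

definition chi_enat :: "enat \<Rightarrow> enat \<Rightarrow> real" where
  "chi_enat m n = (if m = n then 0 else 1 / 2 ^ (the_enat (min m n) + 1))"

definition chi_prod :: "enat \<times> 'm::metric_space \<Rightarrow> enat \<times> 'm \<Rightarrow> real" where
  "chi_prod p q = chi_enat (fst p) (fst q) + dist (snd p) (snd q)"


section \<open>Kernels\<close>

definition kernel_candidate ::
    "(nat \<Rightarrow> 'm::topological_space set) \<Rightarrow> 'm \<Rightarrow> 'm set \<Rightarrow> bool" where
  "kernel_candidate Os p W \<longleftrightarrow> open W \<and> connected W \<and> p \<in> W \<and>
     (\<forall>K. compact K \<and> K \<subseteq> W \<longrightarrow> (\<forall>\<^sub>F n in sequentially. K \<subseteq> Os n))"

definition is_kernel :: "(nat \<Rightarrow> 'm::topological_space set) \<Rightarrow> 'm \<Rightarrow> 'm set \<Rightarrow> bool" where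
  "is_kernel Os p W \<longleftrightarrow>
     (\<forall>n. open (Os n) \<and> connected (Os n) \<and> p \<in> Os n) \<and>
     kernel_candidate Os p W \<and> (\<forall>W'. kernel_candidate Os p W' \<longrightarrow> W' \<subseteq> W)"

end

theory Submission
  imports Defs
begin

text \<open>Everything rests on one fact: nonescaping hyperbolicity is an open condition for
  \<^const>\<open>chi_dyn\<close>. Granted this, every parameter \<open>l\<close> with \<open>f \<infinity> l\<close> hyperbolic has a neighbourhood
  that lies in the hyperbolic locus of \<open>f n\<close> for all large \<open>n\<close>. Fix \<open>p\<close> in \<open>H_inf\<close> and let \<open>C n\<close> be
  the component of the hyperbolic locus of \<open>f n\<close> that contains \<open>p\<close>. The points of \<open>H_inf\<close> with a
  neighbourhood eventually swallowed by \<open>C n\<close> form a clopen subset of \<open>H_inf\<close>, hence all of it, so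
  \<open>H_inf\<close> competes for the kernel of the \<open>C n\<close> at \<open>p\<close>, which is the union of all competitors
  (\<open>component_in_kernel_of_components\<close>). Manifolds are locally connected, which makes components
  of hyperbolic loci open and provides the small connected neighbourhoods of this argument.

  Openness follows from a trapping argument. Let \<open>P\<close> be the postsingular set of a nonescaping
  hyperbolic \<open>f\<close>, a compact forward invariant subset of the Fatou set. If some iterate satisfies
  \<open>\<bar>(f\<^sup>N)'\<bar> < 1\<close> on \<open>P\<close>, it maps a closed tube around \<open>P\<close> well inside itself; the same
  tube then traps \<open>g\<^sup>N\<close> for \<open>g\<close> close to \<open>f\<close>, and it contains the singular set of \<open>g\<close> when that is
  close to the singular set of \<open>f\<close>. So all iterates of \<open>g\<close> are bounded near the postsingular set of
  \<open>g\<close>, which Montel's theorem places in the Fatou set (\<open>nonescaping_hyperbolic_stable\<close>).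

  The contracting iterate comes from an argument that bypasses the classification of Fatou
  components. If there were none, normality near \<open>P\<close> would yield a nonconstant limit of iterates
  \<open>f\<^bsup>n(k)\<^esup>\<close>, and the differences of consecutive \<open>n(k)\<close> would give exponents \<open>m(k) \<ge> 1\<close> with
  \<open>f\<^bsup>m(k)\<^esup>\<close> converging to the identity near some point of \<open>P\<close>
  (\<open>iterate_contracts_on_postsingular\<close>). Such convergence spreads over the whole plane
  (\<open>no_identity_limit\<close>): near the postsingular set by normality and the identity theorem, and away
  from it because the inverse branches of \<open>f\<^bsup>m(k)\<^esup>\<close> exist there and omit a forward invariant set
  around \<open>P\<close>, hence are normal by Schottky's theorem. An entire map whose iterates return to the
  identity everywhere is injective, hence affine, and affine maps are excluded.\<close>

section \<open>Injective entire maps and inverse branches of iterates\<close>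

text \<open>The quotient \<open>z / (f z - f 0)\<close> is entire and zero-free after its singularity at \<open>0\<close> is
  removed. By the open mapping theorem and injectivity \<open>f z\<close> stays away from \<open>f 0\<close> for
  \<open>\<bar>z\<bar> \<ge> 1\<close>, so the quotient grows at most linearly; a zero-free polynomial of degree at most one
  is constant.\<close>

lemma entire_inj_imp_affine:
  assumes holf: "f holomorphic_on UNIV" and inj: "inj f"
  shows "\<exists>a b. \<forall>z. f z = a * z + b"
proof -
  define q where "q z = (if z = 0 then deriv f 0 else (f z - f 0) / (z - 0))" for z
  have holq: "q holomorphic_on UNIV"
    unfolding q_def using pole_lemma_open[OF holf open_UNIV, of 0] by simp
  have q_nz: "q z \<noteq> 0" for z
    using holomorphic_injective_imp_regular[OF holf open_UNIV inj, of 0] injD[OF inj, of z 0]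
    by (auto simp: q_def)
  have fq: "f z = f 0 + z * q z" for z
    by (simp add: q_def)
  have "\<not> f constant_on UNIV"
  proof
    assume "f constant_on UNIV"
    then have "f 0 = f 1" by (auto simp: constant_on_def)
    then show False using injD[OF inj, of 0 1] by simp
  qed
  then have "open (f ` ball 0 1)"
    by (intro open_mapping_thm[OF holf]) auto
  then obtain e where e: "e > 0" "ball (f 0) e \<subseteq> f ` ball 0 1"
    by (metis centre_in_ball imageI open_contains_ball zero_less_one)
  have far: "e \<le> norm (f z - f 0)" if z: "1 \<le> norm z" for z
  proof (rule ccontr)
    assume "\<not> e \<le> norm (f z - f 0)"
    then have "f z \<in> ball (f 0) e" by (simp add: dist_norm norm_minus_commute)
    then obtain y where "y \<in> ball 0 1" "f z = f y" using e(2) by blast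
    then have "z \<in> ball 0 1" using inj by (auto dest: injD)
    then show False using z by simp
  qed
  define h where "h z = 1 / q z" for z
  have holh: "h holomorphic_on UNIV"
    unfolding h_def by (intro holomorphic_intros holq) (use q_nz in auto)
  have "norm (h z) \<le> (1 / e) * norm z ^ 1" if z: "1 \<le> norm z" for z
  proof -
    have "z \<noteq> 0" using z by auto
    then have "norm (q z) * norm z = norm (f z - f 0)"
      by (simp add: q_def norm_divide)
    then have "e \<le> norm (q z) * norm z" using far[OF z] by simp
    then show ?thesis
      using e(1) q_nz[of z] by (simp add: h_def norm_divide field_simps)
  qed
  then have L: "h z = (\<Sum>k\<le>1. (deriv ^^ k) h 0 / fact k * z ^ k)" for z
    by (rule Liouville_polynomial[OF holh])
  have h: "h z = h 0 + deriv h 0 * z" for z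
    by (subst L) simp
  have "deriv h 0 = 0"
  proof (rule ccontr)
    assume "deriv h 0 \<noteq> 0"
    then have "h (- h 0 / deriv h 0) = 0" by (subst h) simp
    then show False using q_nz by (auto simp: h_def)
  qed
  then have "q z = q 0" for z
    using h[of z] q_nz[of z] q_nz[of 0] by (simp add: h_def)
  then have "f z = q 0 * z + f 0" for z
    by (metis add.commute fq mult.commute)
  then show ?thesis by blast
qed

lemma Hol_starD:
  assumes "f \<in> Hol_star"
  shows "f holomorphic_on UNIV" "\<not> inj f"
proof -
  show hol: "f holomorphic_on UNIV"
    using assms by (simp add: Hol_star_def entire_def)
  show "\<not> inj f"
    using entire_inj_imp_affine[OF hol] assms by (auto simp: Hol_star_def)
qed

text \<open>Without singular values \<open>f\<close> would cover the simply connected plane, hence be injective.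
  Nonemptiness is what makes the Hausdorff distance of singular sets meaningful: the infimum that
  defines it runs over the empty set when exactly one of the two sets is empty.\<close>

lemma singular_set_nonempty:
  assumes f: "f \<in> Hol_star"
  shows "singular_set f \<noteq> {}"
proof
  assume "singular_set f = {}"
  then have cov: "covering_space UNIV f UNIV"
    using singular_set_least(2)[OF f] by simp
  have cont: "continuous_on UNIV f"
    using Hol_starD(1)[OF f] by (rule holomorphic_on_imp_continuous_on)
  have "inj f"
  proof (rule injI)
    fix x y assume xy: "f x = f y"
    obtain g where g: "continuous_on UNIV g" "g (f x) = x" "\<And>z. f (g z) = z"
    proof (rule covering_space_lift_strong[OF cov, of x "f x" UNIV id])
      show "locally path_connected (UNIV :: complex set)"
        by (simp add: convex_imp_locally_path_connected)
    qed (auto simp: convex_imp_simply_connected intro: that)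
    have "continuous_on UNIV (g \<circ> f)"
      by (rule continuous_on_compose[OF cont continuous_on_subset[OF g(1)]]) simp
    then have "(g \<circ> f) y = id y"
    proof (intro covering_space_lift_unique[OF cov, of "g \<circ> f" x id UNIV f y])
      show "(g \<circ> f) x = id x" by (simp add: g(2))
      show "f z = f ((g \<circ> f) z)" for z by (simp add: g(3))
    qed (use cont in auto)
    then show "x = y" using g(2) xy by simp
  qed
  then show False using Hol_starD(2)[OF f] by simp
qed

lemma holomorphic_funpow:
  assumes "f holomorphic_on UNIV"
  shows "(f ^^ n) holomorphic_on A"
proof -
  have "(f ^^ n) holomorphic_on UNIV"
  proof (induction n)
    case (Suc n)
    then show ?case
      unfolding funpow.simps(2) by (rule holomorphic_on_compose_gen[OF _ assms]) simp_all
  qed (simp add: holomorphic_on_id[unfolded id_def] id_def)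
  then show ?thesis by (rule holomorphic_on_subset) simp
qed

lemma continuous_on_funpow:
  assumes "f holomorphic_on UNIV"
  shows "continuous_on A ((f :: complex \<Rightarrow> complex) ^^ n)"
  using holomorphic_funpow[OF assms] by (rule holomorphic_on_imp_continuous_on)

lemma funpow_mem:
  assumes "f ` K \<subseteq> K" "x \<in> K"
  shows "(f ^^ n) x \<in> K"
  using assms by (induction n) auto

text \<open>If \<open>K\<close> is forward invariant and contains the singular values, then preimages of points
  outside \<open>K\<close> are outside \<open>K\<close> too. So the lifting property of the covering \<open>f\<close> applies \<open>m\<close> times in
  a row, and every inverse branch of \<open>f\<^sup>m\<close> on a disc disjoint from \<open>K\<close> omits \<open>K\<close>. Lifting a
  map \<open>h\<close> instead of the identity is what the induction on \<open>m\<close> requires.\<close>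

lemma lift_along_iterate:
  fixes f :: "complex \<Rightarrow> complex"
  assumes f: "f \<in> Hol_star" and S: "singular_set f \<subseteq> K" and inv: "f ` K \<subseteq> K"
    and h: "h holomorphic_on ball b R" "h \<in> ball b R \<rightarrow> - K" and R: "R > 0"
    and y: "(f ^^ m) y = h b"
  obtains g where "g holomorphic_on ball b R" "g \<in> ball b R \<rightarrow> - K" "g b = y"
    "\<And>z. z \<in> ball b R \<Longrightarrow> (f ^^ m) (g z) = h z"
  using h y
proof (induction m arbitrary: h thesis)
  case 0
  then show ?case by simp
next
  case (Suc m)
  let ?C = "UNIV - f -` singular_set f"
  have holf: "f holomorphic_on UNIV" by (rule Hol_starD(1)[OF f])
  have cov: "covering_space ?C f (UNIV - singular_set f)"
    by (rule singular_set_least(2)[OF f])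
  have him: "h \<in> ball b R \<rightarrow> UNIV - singular_set f"
    using Suc.prems(3) S by auto
  have hb: "h b \<notin> singular_set f" using him R by auto
  have contf: "continuous_on UNIV f" by (rule holomorphic_on_imp_continuous_on[OF holf])
  obtain h1 where h1: "continuous_on (ball b R) h1" "h1 \<in> ball b R \<rightarrow> ?C"
      "h1 b = (f ^^ m) y" "\<And>z. z \<in> ball b R \<Longrightarrow> f (h1 z) = h z"
  proof (rule covering_space_lift_strong[OF cov, of "(f ^^ m) y" b "ball b R" h])
    show "(f ^^ m) y \<in> ?C" "h b = f ((f ^^ m) y)"
      using Suc.prems(4) hb by auto
    show "continuous_on (ball b R) h"
      using Suc.prems(2) by (rule holomorphic_on_imp_continuous_on)
  qed (use R him in \<open>auto simp: convex_imp_simply_connected convex_imp_locally_path_connected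
        intro: that\<close>)
  have "h1 holomorphic_on ball b R"
  proof (rule covering_space_lift_is_holomorphic[OF cov _ _ Suc.prems(2) him h1(2,1,4)])
    show "open ?C"
      using singular_set_least(1)[OF f] contf
      by (simp add: open_Diff closed_vimage)
    show "f holomorphic_on ?C" using holf by (rule holomorphic_on_subset) simp
  qed auto
  moreover have "h1 \<in> ball b R \<rightarrow> - K"
  proof
    fix z assume z: "z \<in> ball b R"
    then have "f (h1 z) \<notin> K" using h1(4) Suc.prems(3) by auto
    then show "h1 z \<in> - K" using inv by auto
  qed
  moreover have "(f ^^ m) y = h1 b" using h1(3) by simp
  ultimately obtain g where g: "g holomorphic_on ball b R" "g \<in> ball b R \<rightarrow> - K" "g b = y"
      "\<And>z. z \<in> ball b R \<Longrightarrow> (f ^^ m) (g z) = h1 z"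
    by (rule Suc.IH[rotated]) auto
  show ?case
    by (rule Suc.prems(1)[OF g(1-3)]) (simp add: g(4) h1(4))
qed


section \<open>Iterates do not converge to the identity\<close>

lemma uniform_limitD_subseq:
  assumes "uniform_limit X F l sequentially" "strict_mono (s :: nat \<Rightarrow> nat)"
  shows "uniform_limit X (\<lambda>k. F (s k)) l sequentially"
  using assms(1) filterlim_subseq[OF assms(2)] by (rule filterlim_compose)

lemma uniform_limit_via_subseqs:
  fixes F :: "nat \<Rightarrow> 'a \<Rightarrow> 'b::metric_space"
  assumes sub: "\<And>s :: nat \<Rightarrow> nat. strict_mono s \<Longrightarrow>
      \<exists>t :: nat \<Rightarrow> nat. strict_mono t \<and> uniform_limit X (\<lambda>k. F (s (t k))) l sequentially"
  shows "uniform_limit X F l sequentially"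
proof (rule uniform_limitI)
  fix e :: real assume e: "e > 0"
  let ?P = "\<lambda>k. \<forall>x\<in>X. dist (F k x) (l x) < e"
  show "\<forall>\<^sub>F k in sequentially. ?P k"
  proof (rule ccontr)
    assume "\<not> (\<forall>\<^sub>F k in sequentially. ?P k)"
    then have "infinite {k. \<not> ?P k}"
      unfolding eventually_sequentially infinite_nat_iff_unbounded_le by blast
    then obtain s :: "nat \<Rightarrow> nat" where s: "strict_mono s" "\<forall>k. s k \<in> {k. \<not> ?P k}"
      using infinite_enumerate by blast
    obtain t where "uniform_limit X (\<lambda>k. F (s (t k))) l sequentially"
      using sub[OF s(1)] by blast
    then have "\<forall>\<^sub>F k in sequentially. ?P (s (t k))"
      using e by (rule uniform_limitD)
    then obtain k where "?P (s (t k))"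
      using eventually_happens sequentially_bot by blast
    then show False using s(2) by blast
  qed
qed

lemma tendsto_uniform_limit_compose:
  fixes F :: "nat \<Rightarrow> 'a::metric_space \<Rightarrow> 'b::metric_space"
  assumes F: "uniform_limit X F l sequentially"
    and l: "isCont l u" and v: "v \<longlonglongrightarrow> u" and X: "\<forall>\<^sub>F k in sequentially. v k \<in> X"
  shows "(\<lambda>k. F k (v k)) \<longlonglongrightarrow> l u"
proof (rule tendstoI)
  fix e :: real assume e: "e > 0"
  have "(\<lambda>k. l (v k)) \<longlonglongrightarrow> l u" by (rule isCont_tendsto_compose[OF l v])
  then have "\<forall>\<^sub>F k in sequentially. dist (l (v k)) (l u) < e / 2"
    using e by (intro tendstoD) auto
  moreover have "\<forall>\<^sub>F k in sequentially. \<forall>x\<in>X. dist (F k x) (l x) < e / 2"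
    using F e by (intro uniform_limitD) auto
  ultimately show "\<forall>\<^sub>F k in sequentially. dist (F k (v k)) (l u) < e"
    using X
  proof eventually_elim
    case (elim k)
    then have "dist (F k (v k)) (l (v k)) < e / 2" by blast
    then show ?case using elim(1) dist_triangle[of "F k (v k)" "l u" "l (v k)"] by linarith
  qed
qed

text \<open>Schottky's theorem for an arbitrary disc and an arbitrary pair of omitted values. The radius
  ratio \<open>13/16\<close> is \<open>7/8\<close> (shrinking the open disc to a closed one) times \<open>13/14\<close>; it exceeds
  \<open>3/4\<close>, which leaves room for a closed disc of radius \<open>3/4 * R\<close> on which convergence is uniform.\<close>

lemma Schottky_ball:
  fixes g :: "complex \<Rightarrow> complex"
  assumes g: "g holomorphic_on ball b R" and R: "R > 0"
    and cd: "c \<noteq> d" "\<And>z. z \<in> ball b R \<Longrightarrow> g z \<noteq> c \<and> g z \<noteq> d"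
    and B: "norm (g b) \<le> B"
    and z: "norm (z - b) \<le> 13/16 * R"
  shows "norm (g z) \<le> norm c + norm (d - c) *
    exp (pi * exp (pi * (2 + 2 * ((B + norm c) / norm (d - c)) + 12 * (13/14) / (1 - 13/14))))"
    (is "_ \<le> _ + _ * ?E")
proof -
  let ?q = "of_real (7/8 * R) :: complex"
  define F where "F w = (g (b + ?q * w) - c) / (d - c)" for w
  have mem: "b + ?q * w \<in> ball b R" if "w \<in> cball 0 1" for w
  proof -
    have "norm (?q * w) \<le> (7/8 * R) * 1"
      unfolding norm_mult using that R by (intro mult_mono) auto
    then show ?thesis using R by (simp add: dist_norm)
  qed
  have dc: "d - c \<noteq> 0" using cd(1) by simp
  have holF: "F holomorphic_on cball 0 1"
    unfolding F_def
    by (intro holomorphic_intros holomorphic_on_compose_gen[OF _ g, unfolded o_def])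
      (use mem dc in auto)
  have not01: "\<not> (F w = 0 \<or> F w = 1)" if "w \<in> cball 0 1" for w
    using cd(2)[OF mem[OF that]] dc by (auto simp: F_def)
  have "norm (g b - c) \<le> B + norm c"
    using B norm_triangle_ineq4[of "g b" c] by linarith
  then have F0: "norm (F 0) \<le> (B + norm c) / norm (d - c)"
    by (simp add: F_def norm_divide divide_right_mono)
  define w where "w = (z - b) / ?q"
  have w: "norm w \<le> 13/14"
  proof -
    have "norm w = norm (z - b) / (7/8 * R)"
      unfolding w_def norm_divide norm_of_real using R by simp
    also have "\<dots> \<le> 13/14" using z R by (simp add: divide_le_eq)
    finally show ?thesis .
  qed
  have "norm (F w) \<le> ?E"
    by (rule Schottky[OF holF F0 not01 _ _ w]) auto
  moreover have "?q \<noteq> 0" using R by simp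
  then have "b + ?q * w = z"
    unfolding w_def by (simp only: times_divide_eq_right nonzero_mult_div_cancel_left add_diff_cancel_left') simp
  then have "F w = (g z - c) / (d - c)"
    by (simp only: F_def)
  ultimately have "norm (g z - c) \<le> norm (d - c) * ?E"
    using dc by (simp add: norm_divide field_simps)
  then show ?thesis using norm_triangle_ineq2[of "g z" c] by linarith
qed

text \<open>By Brouwer's theorem a map that displaces points by at most \<open>e\<close> covers everything that is
  at distance at least \<open>e\<close> from the boundary of the disc.\<close>

lemma almost_identity_surj:
  fixes h :: "complex \<Rightarrow> complex"
  assumes "continuous_on (cball b r) h" "r > 0"
    and "\<And>y. y \<in> cball b r \<Longrightarrow> norm (h y - y) \<le> e" and "dist b x + e \<le> r"
  obtains y where "y \<in> cball b r" "h y = x"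
proof -
  have "\<exists>y\<in>cball b r. h y = x"
  proof (rule brouwer_surjective_cball[OF assms(1,2), of x "{x}"])
    fix x' y assume *: "x' \<in> {x}" "y \<in> cball b r"
    have "dist b (x' + (y - h y)) \<le> dist b x + norm (h y - y)"
      using * norm_triangle_ineq[of "b - x" "h y - y"] by (simp add: dist_norm algebra_simps)
    then show "x' + (y - h y) \<in> cball b r"
      using assms(3)[OF *(2)] assms(4) by simp
  qed simp
  then show ?thesis using that by blast
qed

text \<open>Take the inverse branches \<open>g k\<close> of \<open>f\<^bsup>m(k)\<^esup>\<close> on the disc that send the centre to a
  nearby point. They omit \<open>c\<close> and \<open>d\<close> and are bounded at the centre, so a subsequence converges.
  Near the centre \<open>f\<^bsup>m(k)\<^esup>\<close> is almost the identity, hence so is its inverse, and the limit is the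
  identity on the whole disc. Inverting once more gives the convergence of \<open>f\<^bsup>m(k)\<^esup>\<close> on the
  disc of half the radius.\<close>

lemma identity_limit_spreads_off_postsingular:
  assumes f: "f \<in> Hol_star" and S: "singular_set f \<subseteq> K" and inv: "f ` K \<subseteq> K"
    and cd: "c \<in> K" "d \<in> K" "c \<noteq> d" and R: "R > 0" "ball b R \<inter> K = {}"
    and \<rho>: "\<rho> > 0" and lim: "uniform_limit (ball b \<rho>) (\<lambda>k. f ^^ m k) (\<lambda>z. z) sequentially"
  obtains s :: "nat \<Rightarrow> nat" where "strict_mono s"
    "uniform_limit (ball b (R/2)) (\<lambda>k. f ^^ m (s k)) (\<lambda>z. z) sequentially"
proof -
  have holf: "f holomorphic_on UNIV" by (rule Hol_starD(1)[OF f])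
  have "\<forall>\<^sub>F k in sequentially. \<forall>x\<in>ball b \<rho>. dist ((f ^^ m k) x) x < \<rho> / 2"
    using lim \<rho> by (intro uniform_limitD) auto
  then obtain k0 where k0: "\<And>k x. k \<ge> k0 \<Longrightarrow> x \<in> ball b \<rho> \<Longrightarrow> dist ((f ^^ m k) x) x < \<rho> / 2"
    unfolding eventually_sequentially by blast
  define M where "M k = m (k + k0)" for k
  have limM: "uniform_limit (ball b \<rho>) (\<lambda>k. f ^^ M k) (\<lambda>z. z) sequentially"
    unfolding M_def by (rule uniform_limitD_subseq[OF lim]) (simp add: strict_mono_def)
  have "\<exists>y. y \<in> cball b (\<rho>/2) \<and> (f ^^ M k) y = b" for k
  proof -
    have *: "norm ((f ^^ M k) y - y) \<le> \<rho> / 2" if "y \<in> cball b (\<rho>/2)" for y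
    proof -
      have "y \<in> ball b \<rho>" using that \<rho> by auto
      then show ?thesis using k0[of "k + k0" y] by (simp add: M_def dist_norm)
    qed
    obtain y where "y \<in> cball b (\<rho>/2)" "(f ^^ M k) y = b"
      by (rule almost_identity_surj[OF continuous_on_funpow[OF holf], of "\<rho>/2" b "M k" "\<rho>/2" b])
        (use * \<rho> in auto)
    then show ?thesis by blast
  qed
  then obtain y where y: "\<And>k. y k \<in> cball b (\<rho>/2)" "\<And>k. (f ^^ M k) (y k) = b" by metis
  have yball: "y k \<in> ball b \<rho>" for k
    using y(1)[of k] \<rho> by auto
  have ylim: "y \<longlonglongrightarrow> b"
  proof (rule tendstoI)
    fix e :: real assume "e > 0"
    with limM have "\<forall>\<^sub>F k in sequentially. \<forall>x\<in>ball b \<rho>. dist ((f ^^ M k) x) x < e"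
      by (rule uniform_limitD)
    then show "\<forall>\<^sub>F k in sequentially. dist (y k) b < e"
    proof eventually_elim
      case (elim k)
      then have "dist ((f ^^ M k) (y k)) (y k) < e" using yball by blast
      then show ?case by (simp add: y(2) dist_commute)
    qed
  qed
  have "\<exists>g. g holomorphic_on ball b R \<and> g \<in> ball b R \<rightarrow> - K \<and> g b = y k \<and>
      (\<forall>z\<in>ball b R. (f ^^ M k) (g z) = z)" for k
  proof -
    obtain g where "g holomorphic_on ball b R" "g \<in> ball b R \<rightarrow> - K" "g b = y k"
      "\<And>z. z \<in> ball b R \<Longrightarrow> (f ^^ M k) (g z) = (\<lambda>z. z) z"
      by (rule lift_along_iterate[OF f S inv, of "\<lambda>z. z" b R "M k" "y k"])
        (use R y(2) in auto)
    then show ?thesis by auto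
  qed
  then obtain g where g: "\<And>k. g k holomorphic_on ball b R" "\<And>k. g k \<in> ball b R \<rightarrow> - K"
      "\<And>k. g k b = y k" "\<And>k z. z \<in> ball b R \<Longrightarrow> (f ^^ M k) (g k z) = z" by metis
  \<comment> \<open>the radius up to which Schottky's theorem bounds the branches\<close>
  let ?r = "13/16 * R"
  have sub: "ball b ?r \<subseteq> ball b R" using R by (intro subset_ball) auto
  have gy: "norm (g k b) \<le> norm b + \<rho>" for k
    using yball[of k] norm_triangle_ineq2[of "y k" b] by (simp add: g(3) dist_norm norm_minus_commute)
  have nocd: "g k z \<noteq> c \<and> g k z \<noteq> d" if "z \<in> ball b R" for k z
    using g(2)[of k] that cd by auto
  have "\<exists>C. \<forall>k. \<forall>z\<in>ball b ?r. norm (g k z) \<le> C"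
  proof (intro exI allI ballI)
    fix k z assume "z \<in> ball b ?r"
    then have "norm (z - b) \<le> ?r" by (simp add: dist_norm norm_minus_commute)
    from Schottky_ball[OF g(1) R(1) cd(3) nocd gy this]
    show "norm (g k z) \<le> norm c + norm (d - c) * exp (pi * exp (pi * (2 + 2 *
        ((norm b + \<rho> + norm c) / norm (d - c)) + 12 * (13/14) / (1 - 13/14))))" .
  qed
  then obtain C where C: "\<And>k z. z \<in> ball b ?r \<Longrightarrow> norm (g k z) \<le> C" by blast
  obtain G r where G: "G holomorphic_on ball b ?r" and r: "strict_mono (r :: nat \<Rightarrow> nat)"
    and ptw: "\<And>x. x \<in> ball b ?r \<Longrightarrow> (\<lambda>k. g (r k) x) \<longlonglongrightarrow> G x"
    and unif: "\<And>L. compact L \<Longrightarrow> L \<subseteq> ball b ?r \<Longrightarrow> uniform_limit L (g \<circ> r) G sequentially"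
  proof (rule Montel[of "ball b ?r" "range g" g])
    show "h holomorphic_on ball b ?r" if "h \<in> range g" for h
      using that g(1) holomorphic_on_subset[OF _ sub] by auto
    show "\<exists>B. \<forall>h\<in>range g. \<forall>z\<in>L. norm (h z) \<le> B" if "L \<subseteq> ball b ?r" for L
      using C that by (intro exI[of _ C]) auto
  qed auto
  have b_in: "b \<in> ball b ?r" using R by simp
  have contG: "continuous_on (ball b ?r) G"
    by (rule holomorphic_on_imp_continuous_on[OF G])
  have "G b = b"
    using ptw[OF b_in] LIMSEQ_subseq_LIMSEQ[OF ylim r]
    by (simp add: g(3) o_def LIMSEQ_unique)
  \<comment> \<open>Where \<open>G z\<close> lies in the disc of uniform convergence, letting \<open>k\<close> tend to infinity in
      \<open>f\<^bsup>m(k)\<^esup> (g k z) = z\<close> gives \<open>G z = z\<close>.\<close>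
  define V where "V = {z \<in> ball b ?r. G z \<in> ball b \<rho>}"
  have V: "open V" "b \<in> V" "V \<subseteq> ball b ?r"
    using continuous_open_preimage[OF contG open_ball open_ball, of b \<rho>] b_in \<open>G b = b\<close> \<rho>
    by (auto simp: V_def vimage_def Int_def)
  have GV: "G z = z" if z: "z \<in> V" for z
  proof -
    have z': "z \<in> ball b ?r" "G z \<in> ball b \<rho>" using z by (auto simp: V_def)
    have "\<forall>\<^sub>F k in sequentially. g (r k) z \<in> ball b \<rho>"
      by (rule topological_tendstoD[OF ptw[OF z'(1)] open_ball z'(2)])
    then have "(\<lambda>k. (f ^^ M (r k)) (g (r k) z)) \<longlonglongrightarrow> G z"
      by (intro tendsto_uniform_limit_compose[OF uniform_limitD_subseq[OF limM r] _ ptw[OF z'(1)]]) auto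
    then have "(\<lambda>k. z) \<longlonglongrightarrow> G z"
      using g(4) z'(1) sub by (auto simp: subset_iff)
    then show ?thesis by (simp add: LIMSEQ_const_iff)
  qed
  have Gid: "G z = z" if "z \<in> ball b ?r" for z
    by (rule analytic_continuation_open[OF V(1) open_ball _ connected_ball V(3) G _ GV that])
      (use V(2) in auto)
  define s where "s k = r k + k0" for k
  have "strict_mono s" using r by (simp add: strict_mono_def s_def)
  moreover have "uniform_limit (ball b (R/2)) (\<lambda>k. f ^^ m (s k)) (\<lambda>z. z) sequentially"
  proof (rule uniform_limitI)
    fix e :: real assume e: "e > 0"
    let ?e = "min e (R/4)"
    have sub': "cball b (3/4 * R) \<subseteq> ball b ?r" using R by auto
    have "uniform_limit (cball b (3/4 * R)) (g \<circ> r) G sequentially"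
      by (rule unif[OF compact_cball sub'])
    moreover have "?e > 0" using e R by simp
    ultimately have "\<forall>\<^sub>F k in sequentially. \<forall>z\<in>cball b (3/4 * R). dist ((g \<circ> r) k z) (G z) < ?e"
      by (rule uniform_limitD)
    then show "\<forall>\<^sub>F k in sequentially. \<forall>x\<in>ball b (R/2). dist ((f ^^ m (s k)) x) x < e"
    proof eventually_elim
      case (elim k)
      have near: "norm (g (r k) z - z) < ?e" if "z \<in> cball b (3/4 * R)" for z
        using elim that Gid sub' by (force simp: dist_norm)
      show ?case
      proof
        fix x assume x: "x \<in> ball b (R/2)"
        \<comment> \<open>\<open>x\<close> is a value of the branch, so \<open>f\<^bsup>m(k)\<^esup>\<close> maps \<open>x\<close> back to a nearby point.\<close>
        obtain u where u: "u \<in> cball b (3/4 * R)" "g (r k) u = x"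
        proof (rule almost_identity_surj[of b "3/4 * R" "g (r k)" "R/4" x])
          show "continuous_on (cball b (3/4 * R)) (g (r k))"
            using holomorphic_on_imp_continuous_on[OF g(1)] sub sub' continuous_on_subset
            by (meson subset_trans)
          show "norm (g (r k) y - y) \<le> R/4" if "y \<in> cball b (3/4 * R)" for y
            using near[OF that] by simp
        qed (use R x in auto)
        have "(f ^^ m (s k)) x = u"
        proof -
          have "u \<in> ball b R" using u(1) sub sub' by blast
          then show ?thesis using g(4)[of u "r k"] u(2) by (simp add: M_def s_def)
        qed
        then show "dist ((f ^^ m (s k)) x) x < e"
          using near[OF u(1)] u(2) by (simp add: dist_norm norm_minus_commute)
      qed
    qed
  qed
  ultimately show ?thesis by (rule that)
qed

text \<open>A Montel limit that is the identity on the overlap of the two discs is the identity on all of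
  \<open>ball a R\<close>.\<close>

lemma identity_limit_spreads_bounded:
  assumes hol: "\<And>k. h k holomorphic_on ball a R"
    and B: "\<And>k z. z \<in> ball a R \<Longrightarrow> norm (h k z) \<le> B"
    and b: "ball b \<rho> \<inter> ball a R \<noteq> {}"
    and lim: "uniform_limit (ball b \<rho>) h (\<lambda>z. z) sequentially"
  obtains s :: "nat \<Rightarrow> nat" where "strict_mono s"
    "uniform_limit (ball a (R/2)) (\<lambda>k. h (s k)) (\<lambda>z. z) sequentially"
proof -
  obtain G r where G: "G holomorphic_on ball a R" and r: "strict_mono (r :: nat \<Rightarrow> nat)"
    and ptw: "\<And>x. x \<in> ball a R \<Longrightarrow> (\<lambda>k. h (r k) x) \<longlonglongrightarrow> G x"
    and unif: "\<And>L. compact L \<Longrightarrow> L \<subseteq> ball a R \<Longrightarrow> uniform_limit L (h \<circ> r) G sequentially"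
  proof (rule Montel[of "ball a R" "range h" h])
    show "\<exists>B. \<forall>h\<in>range h. \<forall>z\<in>L. norm (h z) \<le> B" if "L \<subseteq> ball a R" for L
      using B that by (intro exI[of _ B]) auto
  qed (use hol in auto)
  have "G z = z" if z: "z \<in> ball b \<rho> \<inter> ball a R" for z
    using z ptw[of z] tendsto_uniform_limitI[OF uniform_limitD_subseq[OF lim r], of z]
    by (auto intro: LIMSEQ_unique)
  from analytic_continuation_open[OF open_Int[OF open_ball open_ball] open_ball b connected_ball
      Int_lower2 G _ this]
  have Gid: "G z = z" if "z \<in> ball a R" for z
    using that by (simp add: holomorphic_on_ident)
  have "R > 0" using b by (metis Int_empty_right ball_empty not_le)
  then have sub: "cball a (R/2) \<subseteq> ball a R" by auto
  then have "uniform_limit (cball a (R/2)) (h \<circ> r) G sequentially"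
    by (intro unif) auto
  then have "uniform_limit (cball a (R/2)) (\<lambda>k. h (r k)) (\<lambda>z. z) sequentially"
    using Gid sub by (subst (asm) uniform_limit_cong') (auto simp: o_def)
  then have "uniform_limit (ball a (R/2)) (\<lambda>k. h (r k)) (\<lambda>z. z) sequentially"
    by (rule uniform_limit_on_subset) auto
  with r show ?thesis by (rule that)
qed

text \<open>The set \<open>U\<close> of points near which \<open>f\<^bsup>m(k)\<^esup>\<close> tends to the identity is open by definition.
  It is closed as well: a point of its closure lies either in \<open>K\<close>, where the iterates are locally
  bounded, or off \<open>K\<close>, where inverse branches exist. So \<open>U\<close> is the plane, and since \<open>m k \<ge> 1\<close> the
  values \<open>f x\<close> determine the limit \<open>x\<close>, which makes \<open>f\<close> injective. Two points \<open>c\<close> and \<open>d\<close> in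
  \<open>K\<close> serve as omitted values.\<close>

proposition no_identity_limit:
  assumes f: "f \<in> Hol_star" and K: "closed K" and S: "singular_set f \<subseteq> K" and inv: "f ` K \<subseteq> K"
    and cd: "c \<in> K" "d \<in> K" "c \<noteq> d"
    and bdd: "\<And>x. x \<in> K \<Longrightarrow> \<exists>r>0. \<exists>B. \<forall>n. \<forall>y\<in>ball x r. norm ((f ^^ n) y) \<le> B"
    and m: "\<And>k. m k \<ge> 1"
    and w: "\<rho> > 0" "uniform_limit (ball w \<rho>) (\<lambda>k. f ^^ m k) (\<lambda>z. z) sequentially"
  shows False
proof -
  have holf: "f holomorphic_on UNIV" by (rule Hol_starD(1)[OF f])
  let ?id = "\<lambda>z::complex. z"
  define U where "U = {x. \<exists>r>0. uniform_limit (ball x r) (\<lambda>k. f ^^ m k) ?id sequentially}"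
  have "open U"
    unfolding open_contains_ball
  proof
    fix x assume "x \<in> U"
    then obtain r where r: "r > 0" "uniform_limit (ball x r) (\<lambda>k. f ^^ m k) ?id sequentially"
      by (auto simp: U_def)
    have "y \<in> U" if y: "y \<in> ball x r" for y
    proof -
      have "ball y (r - dist x y) \<subseteq> ball x r"
        by (simp add: subset_ball ball_subset_ball_iff dist_commute)
      then show ?thesis
        using uniform_limit_on_subset[OF r(2)] y unfolding U_def
        by (intro CollectI exI[of _ "r - dist x y"]) auto
    qed
    then show "\<exists>e>0. ball x e \<subseteq> U" using r(1) by blast
  qed
  moreover have "a \<in> U" if a: "a \<in> closure U" for a
  proof (cases "a \<in> K")
    case True
    then obtain R B where R: "R > 0" "\<And>n y. y \<in> ball a R \<Longrightarrow> norm ((f ^^ n) y) \<le> B"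
      using bdd by metis
    obtain b where b: "b \<in> U" "b \<in> ball a R"
      using a R(1) by (auto simp: closure_approachable dist_commute)
    obtain \<sigma> where \<sigma>: "\<sigma> > 0" "uniform_limit (ball b \<sigma>) (\<lambda>k. f ^^ m k) ?id sequentially"
      using b(1) by (auto simp: U_def)
    have "uniform_limit (ball a (R/2)) (\<lambda>k. f ^^ m k) ?id sequentially"
    proof (rule uniform_limit_via_subseqs)
      fix s :: "nat \<Rightarrow> nat" assume s: "strict_mono s"
      obtain t :: "nat \<Rightarrow> nat" where "strict_mono t"
        "uniform_limit (ball a (R/2)) (\<lambda>k. f ^^ m (s (t k))) ?id sequentially"
      proof (rule identity_limit_spreads_bounded[of "\<lambda>k. f ^^ m (s k)" a R B b \<sigma>])
        show "ball b \<sigma> \<inter> ball a R \<noteq> {}" using b(2) \<sigma>(1) by (metis IntI centre_in_ball empty_iff)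
      qed (use holomorphic_funpow[OF holf] R(2) uniform_limitD_subseq[OF \<sigma>(2) s] in auto)
      then show "\<exists>t. strict_mono t \<and>
          uniform_limit (ball a (R/2)) (\<lambda>k. f ^^ m (s (t k))) ?id sequentially" by blast
    qed
    then show ?thesis using R(1) unfolding U_def by (intro CollectI exI[of _ "R/2"]) auto
  next
    case False
    \<comment> \<open>A point \<open>b\<close> of \<open>U\<close> within \<open>R\<close> of \<open>a\<close> has a disc of radius \<open>3 * R\<close> off \<open>K\<close>; convergence
        spreads to half of it, which still contains \<open>ball a (R / 2)\<close>.\<close>
    obtain R0 where R0: "R0 > 0" "ball a R0 \<subseteq> - K"
      using open_contains_ball[of "- K"] K False by (auto simp: open_Compl)
    define R where "R = R0 / 4"
    have R: "R > 0" "ball a (4 * R) \<inter> K = {}" using R0 by (auto simp: R_def)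
    obtain b where b: "b \<in> U" "dist a b < R"
      using a R(1) by (auto simp: closure_approachable dist_commute)
    have sub: "ball b (3 * R) \<subseteq> ball a (4 * R)"
      using b(2) by (simp add: ball_subset_ball_iff dist_commute)
    obtain \<sigma> where \<sigma>: "\<sigma> > 0" "uniform_limit (ball b \<sigma>) (\<lambda>k. f ^^ m k) ?id sequentially"
      using b(1) by (auto simp: U_def)
    have "uniform_limit (ball b (3 * R / 2)) (\<lambda>k. f ^^ m k) ?id sequentially"
    proof (rule uniform_limit_via_subseqs)
      fix s :: "nat \<Rightarrow> nat" assume s: "strict_mono s"
      obtain t :: "nat \<Rightarrow> nat" where "strict_mono t"
        "uniform_limit (ball b (3 * R / 2)) (\<lambda>k. f ^^ m (s (t k))) ?id sequentially"
      proof (rule identity_limit_spreads_off_postsingular[OF f S inv cd, of "3 * R" b \<sigma> "\<lambda>k. m (s k)"])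
        show "ball b (3 * R) \<inter> K = {}" using sub R(2) by blast
      qed (use R(1) \<sigma>(1) uniform_limitD_subseq[OF \<sigma>(2) s] in auto)
      then show "\<exists>t. strict_mono t \<and>
          uniform_limit (ball b (3 * R / 2)) (\<lambda>k. f ^^ m (s (t k))) ?id sequentially" by blast
    qed
    moreover have "ball a (R / 2) \<subseteq> ball b (3 * R / 2)"
      using b(2) by (simp add: ball_subset_ball_iff dist_commute)
    ultimately have "uniform_limit (ball a (R / 2)) (\<lambda>k. f ^^ m k) ?id sequentially"
      by (rule uniform_limit_on_subset)
    then show ?thesis using R(1) unfolding U_def by (intro CollectI exI[of _ "R/2"]) auto
  qed
  then have "closed U" by (metis closure_subset_eq subsetI)
  moreover have "w \<in> U" using w by (auto simp: U_def)
  ultimately have "U = UNIV" using clopen by blast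
  then have ptw: "(\<lambda>k. (f ^^ m k) x) \<longlonglongrightarrow> x" for x
  proof -
    have "x \<in> U" using \<open>U = UNIV\<close> by simp
    then obtain r where "r > 0" "uniform_limit (ball x r) (\<lambda>k. f ^^ m k) ?id sequentially"
      by (auto simp: U_def)
    from this(2) show ?thesis
      by (rule tendsto_uniform_limitI) (simp add: \<open>r > 0\<close>)
  qed
  have "inj f"
  proof (rule injI)
    fix x y assume "f x = f y"
    moreover have "(f ^^ m k) u = (f ^^ (m k - 1)) (f u)" for k u
    proof -
      have "Suc (m k - 1) = m k" using m[of k] by simp
      then show ?thesis using funpow_simps_right(2)[of "m k - 1" f] by (simp add: fun_eq_iff)
    qed
    ultimately have "(f ^^ m k) x = (f ^^ m k) y" for k by (simp only:)
    then have "(\<lambda>k. (f ^^ m k) y) \<longlonglongrightarrow> x" using ptw[of x] by (simp only:)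
    then show "x = y" using ptw[of y] by (rule LIMSEQ_unique)
  qed
  then show False using Hol_starD(2)[OF f] by simp
qed


section \<open>Contraction on the postsingular set\<close>

text \<open>A bounded orbit rules out that iterates tend to infinity near \<open>z\<close>; the other alternative in
  normality, a finite limit, bounds them.\<close>

lemma Fatou_locally_bounded:
  assumes holf: "f holomorphic_on UNIV" and z: "z \<in> Fatou_set f"
    and b: "\<And>n. norm ((f ^^ n) z) \<le> b"
  shows "\<exists>r>0. \<exists>B. \<forall>n. \<forall>y\<in>ball z r. norm ((f ^^ n) y) \<le> B"
proof -
  obtain U where U: "open U" "z \<in> U" "normal_family U (range (\<lambda>n. f ^^ n))"
    using z by (auto simp: Fatou_set_def)
  obtain r where r: "r > 0" "cball z r \<subseteq> U"
    using U(1,2) open_contains_cball by blast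
  have "\<exists>B. \<forall>n. \<forall>y\<in>ball z r. norm ((f ^^ n) y) \<le> B"
  proof (rule ccontr)
    assume "\<not> ?thesis"
    then have "\<forall>j::nat. \<exists>n y. y \<in> ball z r \<and> real j < norm ((f ^^ n) y)"
      by (meson not_le)
    then obtain n y where y: "\<And>j. y j \<in> ball z r" "\<And>j. real j < norm ((f ^^ n j) (y j))"
      by metis
    have "range (\<lambda>j. f ^^ n j) \<subseteq> range (\<lambda>n. f ^^ n)" by auto
    then obtain q :: "nat \<Rightarrow> nat" where q: "strict_mono q"
      and alt: "(\<exists>h. h holomorphic_on U \<and>
             (\<forall>K. compact K \<and> K \<subseteq> U \<longrightarrow> uniform_limit K (\<lambda>k. f ^^ n (q k)) h sequentially)) \<or>
          (\<forall>K. compact K \<and> K \<subseteq> U \<longrightarrow>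
             (\<forall>B. \<forall>\<^sub>F k in sequentially. \<forall>z\<in>K. norm ((f ^^ n (q k)) z) > B))"
      using U(3) unfolding normal_family_def by meson
    from alt show False
    proof
      assume "\<exists>h. h holomorphic_on U \<and>
          (\<forall>K. compact K \<and> K \<subseteq> U \<longrightarrow> uniform_limit K (\<lambda>k. f ^^ n (q k)) h sequentially)"
      then obtain h where h: "h holomorphic_on U"
        "uniform_limit (cball z r) (\<lambda>k. f ^^ n (q k)) h sequentially"
        using r(2) compact_cball by meson
      have "continuous_on (cball z r) h"
        using holomorphic_on_imp_continuous_on[OF h(1)] r(2) by (rule continuous_on_subset)
      then have "bounded (h ` cball z r)"
        by (intro compact_imp_bounded compact_continuous_image) auto
      then obtain C where C: "\<And>x. x \<in> cball z r \<Longrightarrow> norm (h x) \<le> C"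
        unfolding bounded_iff by blast
      have "\<forall>\<^sub>F k in sequentially. \<forall>x\<in>cball z r. dist ((f ^^ n (q k)) x) (h x) < 1"
        using h(2) by (rule uniform_limitD) simp
      moreover have "\<forall>\<^sub>F k in sequentially. C + 1 \<le> real k"
        by (simp add: eventually_at_top_linorder) (meson nat_ceiling_le_eq)
      ultimately have "\<forall>\<^sub>F k in sequentially. False"
      proof eventually_elim
        case (elim k)
        have y': "y (q k) \<in> cball z r" using y(1) by (rule subsetD[OF ball_subset_cball])
        then have "dist ((f ^^ n (q k)) (y (q k))) (h (y (q k))) < 1" using elim(1) by blast
        then have "norm ((f ^^ n (q k)) (y (q k))) < C + 1"
          using C[OF y'] norm_triangle_ineq2[of "(f ^^ n (q k)) (y (q k))" "h (y (q k))"]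
          by (simp add: dist_norm)
        then show ?case using y(2)[of "q k"] seq_suble[OF q, of k] elim(2) by linarith
      qed
      then show False by simp
    next
      assume "\<forall>K. compact K \<and> K \<subseteq> U \<longrightarrow>
          (\<forall>B. \<forall>\<^sub>F k in sequentially. \<forall>z\<in>K. norm ((f ^^ n (q k)) z) > B)"
      then have "\<forall>\<^sub>F k in sequentially. \<forall>x\<in>{z}. norm ((f ^^ n (q k)) x) > b"
        by (elim allE[of _ "{z}"] impE allE[of _ b]) (use U(2) in auto)
      then have "\<forall>\<^sub>F k in sequentially. False"
      proof eventually_elim
        case (elim k)
        then have "b < norm ((f ^^ n (q k)) z)" by blast
        then show False using b[of "n (q k)"] by simp
      qed
      then show False by simp
    qed
  qed
  then show ?thesis using r(1) by blast
qed

lemma deriv_bound_half_ball: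
  assumes h: "h holomorphic_on ball p e" and e: "e > 0"
    and B: "\<And>y. y \<in> ball p e \<Longrightarrow> norm (h y) \<le> B" and y: "y \<in> ball p (e/2)"
  shows "norm (deriv h y) \<le> 4 * B / e"
proof -
  have sub: "cball y (e/4) \<subseteq> ball p e"
    using y e by (simp add: cball_subset_ball_iff dist_commute)
  then have "ball y (e/4) \<subseteq> ball p e" using ball_subset_cball by blast
  then have "norm ((deriv ^^ 1) h y) \<le> fact 1 * B / (e/4) ^ 1"
    using sub e
    by (intro Cauchy_inequality holomorphic_on_subset[OF h]
        continuous_on_subset[OF holomorphic_on_imp_continuous_on[OF h]] B)
      (auto simp: dist_norm)
  then show ?thesis by (simp add: field_simps)
qed

lemma uniform_bound_near_compact:
  fixes P :: "complex set"
  assumes P: "compact P"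
    and bdd: "\<And>x. x \<in> P \<Longrightarrow> \<exists>r>0. \<exists>B. \<forall>n. \<forall>y\<in>ball x r. norm (h n y) \<le> B"
  obtains e B where "e > 0" "\<And>p y n. p \<in> P \<Longrightarrow> y \<in> ball p e \<Longrightarrow> norm (h n y) \<le> (B::real)"
proof -
  obtain r b where rb: "\<And>x. x \<in> P \<Longrightarrow> r x > (0::real)"
      "\<And>x n y. x \<in> P \<Longrightarrow> y \<in> ball x (r x) \<Longrightarrow> norm (h n y) \<le> b x"
    using bdd by metis
  obtain D where D: "D \<subseteq> P" "finite D" "P \<subseteq> (\<Union>x\<in>D. ball x (r x))"
    by (rule compactE_image[OF P, of P "\<lambda>x. ball x (r x)"]) (use rb(1) in force)+
  obtain e where e: "e > 0" "(\<Union>x\<in>P. ball x e) \<subseteq> (\<Union>x\<in>D. ball x (r x))"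
    using compact_subset_open_imp_ball_epsilon_subset[OF P _ D(3)] by blast
  have "norm (h n y) \<le> Max (b ` D)" if "p \<in> P" "y \<in> ball p e" for p y n
  proof -
    obtain x where x: "x \<in> D" "y \<in> ball x (r x)" using e(2) \<open>p \<in> P\<close> \<open>y \<in> ball p e\<close> by blast
    then have "norm (h n y) \<le> b x" using rb(2) D(1) by blast
    also have "\<dots> \<le> Max (b ` D)" using x D(2) by simp
    finally show ?thesis .
  qed
  with e(1) show ?thesis by (rule that)
qed

text \<open>Local bounds on all iterates become uniform by compactness, and Cauchy's estimate turns them
  into bounds on the derivatives of all iterates. The Lipschitz estimate says that points near \<open>P\<close>
  shadow orbits in \<open>P\<close> for all time.\<close>

lemma equi_Lipschitz_near_invariant_Fatou_compact:
  assumes holf: "f holomorphic_on UNIV" and P: "compact P" "f ` P \<subseteq> P" "P \<subseteq> Fatou_set f"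
  obtains e B where "e > 0" "B \<ge> 1"
    "\<And>p y n. p \<in> P \<Longrightarrow> y \<in> ball p e \<Longrightarrow> norm ((f ^^ n) y) \<le> B"
    "\<And>p y n. p \<in> P \<Longrightarrow> y \<in> ball p e \<Longrightarrow> norm ((f ^^ n) y - (f ^^ n) p) \<le> B * norm (y - p)"
proof -
  obtain b where b: "\<And>x. x \<in> P \<Longrightarrow> norm x \<le> b"
    using compact_imp_bounded[OF P(1)] by (auto simp: bounded_iff)
  have "\<exists>r>0. \<exists>B. \<forall>n. \<forall>y\<in>ball x r. norm ((f ^^ n) y) \<le> B" if "x \<in> P" for x
    using that P(3) by (intro Fatou_locally_bounded[OF holf _ b] funpow_mem[OF P(2)]) auto
  note local_bound = this
  obtain e B0 where e: "e > 0"
      "\<And>p y n. p \<in> P \<Longrightarrow> y \<in> ball p e \<Longrightarrow> norm ((f ^^ n) y) \<le> B0"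
    by (rule uniform_bound_near_compact[OF P(1), of "\<lambda>n. f ^^ n", OF local_bound], assumption) (rule that)
  define B where "B = max 1 (max B0 (4 * B0 / e))"
  show ?thesis
  proof (rule that[of "e/2" B])
    fix p y n assume p: "p \<in> P" and y: "y \<in> ball p (e/2)"
    have "y \<in> ball p e" using y e(1) by auto
    then show "norm ((f ^^ n) y) \<le> B" using e(2)[OF p] by (force simp: B_def le_max_iff_disj)
    show "norm ((f ^^ n) y - (f ^^ n) p) \<le> B * norm (y - p)"
    proof (rule field_differentiable_bound[of "ball p (e/2)"])
      fix z assume z: "z \<in> ball p (e/2)"
      show "((f ^^ n) has_field_derivative deriv (f ^^ n) z) (at z within ball p (e/2))"
        by (rule has_field_derivative_at_within, rule holomorphic_derivI[OF holomorphic_funpow[OF holf] open_UNIV])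
          simp
      have "norm (deriv (f ^^ n) z) \<le> 4 * B0 / e"
        by (rule deriv_bound_half_ball[OF holomorphic_funpow[OF holf] e(1) e(2)[OF p] z])
      then show "norm (deriv (f ^^ n) z) \<le> B" by (simp add: B_def)
    qed (use y e(1) in auto)
  qed (use e(1) in \<open>auto simp: B_def\<close>)
qed

lemma postsingular_set_props:
  assumes f: "f \<in> Hol_star"
  shows "closed (postsingular_set f)" "singular_set f \<subseteq> postsingular_set f"
    "f ` postsingular_set f \<subseteq> postsingular_set f" "postsingular_set f \<noteq> {}"
proof -
  show "closed (postsingular_set f)" by (simp add: postsingular_set_def)
  have "singular_set f \<subseteq> (\<Union>n. (f ^^ n) ` singular_set f)"
    by (rule order_trans[OF _ UN_upper[of 0]]) auto
  then show S: "singular_set f \<subseteq> postsingular_set f"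
    unfolding postsingular_set_def using closure_subset by blast
  then show "postsingular_set f \<noteq> {}" using singular_set_nonempty[OF f] by blast
  let ?O = "\<Union>n. (f ^^ n) ` singular_set f"
  have "f ` closure ?O \<subseteq> closure (f ` ?O)"
    using holomorphic_on_imp_continuous_on[OF Hol_starD(1)[OF f]]
    by (intro continuous_image_closure_subset) auto
  moreover have "f ` ?O \<subseteq> ?O"
  proof clarify
    fix n s assume "s \<in> singular_set f"
    then have "(f ^^ Suc n) s \<in> (f ^^ Suc n) ` singular_set f" by (rule imageI)
    then have "(f ^^ Suc n) s \<in> ?O" by (rule UN_I[OF UNIV_I])
    then show "f ((f ^^ n) s) \<in> ?O" by simp
  qed
  ultimately show "f ` postsingular_set f \<subseteq> postsingular_set f"
    unfolding postsingular_set_def using closure_mono by blast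
qed

text \<open>The postsingular set may be a single point, whereas Schottky's theorem needs two omitted
  values. So \<open>P\<close> is enlarged to the set \<open>K\<close> of all points whose whole orbit stays close to \<open>P\<close>:
  it is closed, forward invariant and still surrounded by bounded iterates, and the equi-Lipschitz
  estimate shows that it contains a neighbourhood of \<open>w\<close>.\<close>

lemma no_recurrence_to_identity:
  assumes f: "f \<in> Hol_star" and P: "compact P" "f ` P \<subseteq> P" "P \<subseteq> Fatou_set f"
      "singular_set f \<subseteq> P" and w: "w \<in> P" and m: "\<And>k. m k \<ge> 1"
    and lim: "\<rho> > 0" "uniform_limit (ball w \<rho>) (\<lambda>k. f ^^ m k) (\<lambda>z. z) sequentially"
  shows False
proof -
  have holf: "f holomorphic_on UNIV" by (rule Hol_starD(1)[OF f])
  have ne: "P \<noteq> {}" using w by blast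
  obtain e B where e: "e > 0" "B \<ge> 1"
    and bd: "\<And>p y n. p \<in> P \<Longrightarrow> y \<in> ball p e \<Longrightarrow> norm ((f ^^ n) y) \<le> B"
    and lip: "\<And>p y n. p \<in> P \<Longrightarrow> y \<in> ball p e \<Longrightarrow>
        norm ((f ^^ n) y - (f ^^ n) p) \<le> B * norm (y - p)"
    by (rule equi_Lipschitz_near_invariant_Fatou_compact[OF holf P(1-3)]) (rule that)
  define K where "K = {x. \<forall>n. infdist ((f ^^ n) x) P \<le> e / 2}"
  have K_closed: "closed K"
  proof -
    have "closed {x. infdist ((f ^^ n) x) P \<le> e / 2}" for n
      by (intro closed_Collect_le continuous_on_infdist continuous_on_funpow[OF holf]
          continuous_on_const)
    then have "closed (\<Inter>n. {x. infdist ((f ^^ n) x) P \<le> e / 2})" by blast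
    moreover have "K = (\<Inter>n. {x. infdist ((f ^^ n) x) P \<le> e / 2})" by (auto simp: K_def)
    ultimately show ?thesis by simp
  qed
  have PK: "P \<subseteq> K"
    using funpow_mem[OF P(2)] e(1) by (auto simp: K_def)
  have K_inv: "f ` K \<subseteq> K"
  proof
    fix y assume "y \<in> f ` K"
    then obtain x where x: "x \<in> K" "y = f x" by blast
    have "infdist ((f ^^ n) y) P \<le> e / 2" for n
      using x(1) unfolding K_def x(2) by (metis (mono_tags, lifting) funpow_swap1 funpow.simps(2) mem_Collect_eq o_apply)
    then show "y \<in> K" by (simp add: K_def)
  qed
  \<comment> \<open>The second omitted value is so close to \<open>w\<close> that its orbit shadows that of \<open>w\<close>.\<close>
  define \<eta> where "\<eta> = e / (4 * B)"
  have \<eta>: "\<eta> > 0" "B * \<eta> \<le> e / 2" "\<eta> < e" using e by (auto simp: \<eta>_def field_simps)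
  have d: "w + of_real \<eta> \<in> K"
    unfolding K_def
  proof (intro CollectI allI)
    fix n
    have "infdist ((f ^^ n) (w + of_real \<eta>)) P \<le> dist ((f ^^ n) (w + of_real \<eta>)) ((f ^^ n) w)"
      by (intro infdist_le funpow_mem[OF P(2) w])
    also have "\<dots> \<le> B * \<eta>"
      using lip[OF w, of "w + of_real \<eta>" n] \<eta> by (simp add: dist_norm)
    finally show "infdist ((f ^^ n) (w + of_real \<eta>)) P \<le> e / 2" using \<eta>(2) by simp
  qed
  show False
  proof (rule no_identity_limit[OF f K_closed _ K_inv, of w "w + of_real \<eta>" m \<rho> w])
    show "singular_set f \<subseteq> K" using P(4) PK by blast
    fix x assume "x \<in> K"
    then have "infdist ((f ^^ 0) x) P \<le> e / 2" unfolding K_def by blast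
    then have "infdist x P < 3/4 * e" using e(1) by simp
    moreover obtain p where "p \<in> P" "infdist x P = dist x p"
      using infdist_attains_inf[OF compact_imp_closed[OF P(1)] ne] by blast
    ultimately have p: "p \<in> P" "dist x p < 3/4 * e" by simp_all
    have "ball x (e/4) \<subseteq> ball p e" using p(2) by (simp add: ball_subset_ball_iff)
    then show "\<exists>r>0. \<exists>B. \<forall>n. \<forall>y\<in>ball x r. norm ((f ^^ n) y) \<le> B"
      using bd[OF p(1)] e(1) by (intro exI[of _ "e/4"] conjI exI[of _ B]) auto
  qed (use m lim d w PK \<eta> in auto)
qed

text \<open>Otherwise for every \<open>N\<close> the derivative of \<open>f\<^sup>N\<close> is at least one in modulus somewhere on
  \<open>P\<close>. These points accumulate at some \<open>z\<close>, and a limit \<open>G\<close> of iterates near \<open>z\<close> is nonconstant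
  because its derivative does not vanish. Passing to the limit in
  \<open>f\<^bsup>n(k+1)\<^esup> = f\<^bsup>m(k)\<^esup> \<circ> f\<^bsup>n(k)\<^esup>\<close> gives \<open>G = \<psi> \<circ> G\<close> for a limit \<open>\<psi>\<close> of
  \<open>f\<^bsup>m(k)\<^esup>\<close>, so \<open>\<psi>\<close> is the identity on the open image of \<open>G\<close>.\<close>

proposition iterate_contracts_on_postsingular:
  assumes f: "f \<in> Hol_star" and P: "compact P" "f ` P \<subseteq> P" "P \<subseteq> Fatou_set f"
      "singular_set f \<subseteq> P"
  obtains N where "\<And>p. p \<in> P \<Longrightarrow> norm (deriv (f ^^ N) p) < 1"
proof (rule ccontr)
  assume no: "\<not> thesis"
  have holf: "f holomorphic_on UNIV" by (rule Hol_starD(1)[OF f])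
  obtain e B where e: "e > 0" "B \<ge> 1"
    and bd: "\<And>p y n. p \<in> P \<Longrightarrow> y \<in> ball p e \<Longrightarrow> norm ((f ^^ n) y) \<le> B"
    by (rule equi_Lipschitz_near_invariant_Fatou_compact[OF holf P(1-3)]) (rule that)
  have montel: "\<exists>G r. G holomorphic_on ball p e \<and> strict_mono (r :: nat \<Rightarrow> nat) \<and>
      (\<forall>K. compact K \<and> K \<subseteq> ball p e \<longrightarrow> uniform_limit K (\<lambda>k. f ^^ n (r k)) G sequentially)"
    if p: "p \<in> P" for p and n :: "nat \<Rightarrow> nat"
  proof -
    obtain G r where "G holomorphic_on ball p e" "strict_mono (r :: nat \<Rightarrow> nat)"
      "\<And>x. x \<in> ball p e \<Longrightarrow> (\<lambda>k. (f ^^ n (r k)) x) \<longlonglongrightarrow> G x"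
      and u: "\<And>L. compact L \<Longrightarrow> L \<subseteq> ball p e \<Longrightarrow> uniform_limit L ((\<lambda>k. f ^^ n k) \<circ> r) G sequentially"
    proof (rule Montel[of "ball p e" "range (\<lambda>k. f ^^ k)" "\<lambda>k. f ^^ n k"])
      show "\<exists>B. \<forall>h\<in>range (\<lambda>k. f ^^ k). \<forall>z\<in>L. norm (h z) \<le> B" if "L \<subseteq> ball p e" for L
        using bd[OF p] that by (intro exI[of _ B]) auto
    qed (use holomorphic_funpow[OF holf] in auto)
    then show ?thesis unfolding o_def by blast
  qed
  have "\<exists>p\<in>P. 1 \<le> norm (deriv (f ^^ N) p)" for N
    using no that not_le by blast
  then obtain x where x: "\<And>N. x N \<in> P" "\<And>N. 1 \<le> norm (deriv (f ^^ N) (x N))" by metis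
  obtain z s where z: "z \<in> P" "strict_mono (s :: nat \<Rightarrow> nat)" "(x \<circ> s) \<longlonglongrightarrow> z"
    using P(1) x(1) unfolding compact_def by metis
  obtain G r where G: "G holomorphic_on ball z e" "strict_mono (r :: nat \<Rightarrow> nat)"
    and unif: "\<And>K. compact K \<Longrightarrow> K \<subseteq> ball z e \<Longrightarrow> uniform_limit K (\<lambda>k. f ^^ s (r k)) G sequentially"
    using montel[OF z(1), of s] by blast
  define n where "n k = s (r k)" for k
  have n: "strict_mono n" using z(2) G(2) by (simp add: n_def strict_mono_def)
  have ptw: "(\<lambda>k. (f ^^ n k) y) \<longlonglongrightarrow> G y" if "y \<in> ball z e" for y
    using unif[of "{y}"] that by (auto simp: n_def intro: tendsto_uniform_limitI)
  \<comment> \<open>If \<open>G\<close> were constant, Cauchy's estimate on discs of radius \<open>e/8\<close> would bound the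
      derivatives at the points \<open>x (n k)\<close>, which approach \<open>z\<close>, by \<open>1/2\<close>.\<close>
  have nonconst: "\<not> G constant_on ball z e"
  proof
    assume "G constant_on ball z e"
    then obtain c where c: "\<And>y. y \<in> ball z e \<Longrightarrow> G y = c" by (auto simp: constant_on_def)
    have sub: "cball z (e/2) \<subseteq> ball z e" using e by auto
    have "\<forall>\<^sub>F k in sequentially. \<forall>y\<in>cball z (e/2). dist ((f ^^ n k) y) (G y) < e / 16"
      unfolding n_def using unif[OF compact_cball sub] e(1) by (intro uniform_limitD) auto
    moreover have "\<forall>\<^sub>F k in sequentially. dist ((x \<circ> s) (r k)) z < e / 4"
      using filterlim_compose[OF z(3) filterlim_subseq[OF G(2)]] e(1) by (intro tendstoD) auto
    ultimately have "\<forall>\<^sub>F k in sequentially. False"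
    proof eventually_elim
      case (elim k)
      have "norm (deriv (\<lambda>y. (f ^^ n k) y - c) (x (n k))) \<le> 4 * (e / 16) / (e / 2)"
      proof (rule deriv_bound_half_ball)
        show "(\<lambda>y. (f ^^ n k) y - c) holomorphic_on ball z (e/2)"
          by (intro holomorphic_intros holomorphic_funpow[OF holf])
        show "x (n k) \<in> ball z (e / 2 / 2)"
          using elim(2) by (simp add: n_def dist_commute)
        show "norm ((f ^^ n k) y - c) \<le> e / 16" if "y \<in> ball z (e/2)" for y
        proof -
          have y: "y \<in> cball z (e/2)" using that by simp
          then have "G y = c" using c sub by blast
          then show ?thesis using elim(1) y by (force simp: dist_norm)
        qed
      qed (use e(1) in auto)
      also have "deriv (\<lambda>y. (f ^^ n k) y - c) (x (n k)) = deriv (f ^^ n k) (x (n k))"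
        using holomorphic_on_imp_differentiable_at[OF holomorphic_funpow[OF holf] open_UNIV UNIV_I]
        by (subst deriv_diff) auto
      finally show ?case using x(2)[of "n k"] e(1) by simp
    qed
    then show False by simp
  qed
  define w where "w = G z"
  have z_in: "z \<in> ball z e" using e by simp
  have w: "w \<in> P"
    unfolding w_def
    by (rule closed_sequentially[OF compact_imp_closed[OF P(1)] _ ptw[OF z_in]])
      (rule funpow_mem[OF P(2) z(1)])
  define m where "m k = n (Suc k) - n k" for k
  have mn: "n (Suc k) = m k + n k" and m1: "m k \<ge> 1" for k
    using strict_monoD[OF n, of k "Suc k"] by (auto simp: m_def)
  obtain \<psi> t where \<psi>: "\<psi> holomorphic_on ball w e" "strict_mono (t :: nat \<Rightarrow> nat)"
    and unif\<psi>: "\<And>K. compact K \<Longrightarrow> K \<subseteq> ball w e \<Longrightarrow> uniform_limit K (\<lambda>k. f ^^ m (t k)) \<psi> sequentially"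
    using montel[OF w, of m] by blast
  define V where "V = {y \<in> ball z e. G y \<in> ball w (e/2)}"
  have contG: "continuous_on (ball z e) G" by (rule holomorphic_on_imp_continuous_on[OF G(1)])
  have V: "open V" "z \<in> V" "V \<subseteq> ball z e"
    using continuous_open_preimage[OF contG open_ball open_ball, of w "e/2"] e(1)
    by (auto simp: V_def vimage_def Int_def w_def)
  have "open (G ` V)"
    by (rule open_mapping_thm[OF G(1) open_ball connected_ball V(1,3) nonconst])
  moreover have "w \<in> G ` V" using V(2) by (simp add: w_def)
  ultimately obtain \<rho> where \<rho>: "\<rho> > 0" "cball w \<rho> \<subseteq> G ` V"
    using open_contains_cball by blast
  have \<psi>_id: "\<psi> u = u" if u: "u \<in> G ` V" for u
  proof -
    obtain y where y: "y \<in> V" "u = G y" using u by blast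
    have y': "y \<in> ball z e" "G y \<in> ball w (e/2)" using y(1) by (auto simp: V_def)
    have sub: "cball w (e/2) \<subseteq> ball w e" using e by auto
    have l1: "(\<lambda>k. (f ^^ n (t k)) y) \<longlonglongrightarrow> G y"
      using filterlim_compose[OF ptw[OF y'(1)] filterlim_subseq[OF \<psi>(2)]] .
    have ev: "\<forall>\<^sub>F k in sequentially. (f ^^ n (t k)) y \<in> cball w (e/2)"
      using topological_tendstoD[OF l1 open_ball y'(2)] by eventually_elim auto
    have "isCont \<psi> (G y)"
      using holomorphic_on_imp_continuous_on[OF \<psi>(1)] y'(2) e(1)
      by (intro continuous_on_interior[of "ball w e"]) auto
    then have "(\<lambda>k. (f ^^ m (t k)) ((f ^^ n (t k)) y)) \<longlonglongrightarrow> \<psi> (G y)"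
      by (rule tendsto_uniform_limit_compose[OF unif\<psi>[OF compact_cball sub] _ l1 ev])
    moreover have "(f ^^ m (t k)) ((f ^^ n (t k)) y) = (f ^^ n (Suc (t k))) y" for k
      by (simp add: mn funpow_add)
    ultimately have "(\<lambda>k. (f ^^ n (Suc (t k))) y) \<longlonglongrightarrow> \<psi> (G y)" by simp
    moreover have "(\<lambda>k. (f ^^ n (Suc (t k))) y) \<longlonglongrightarrow> G y"
      using \<psi>(2)
      by (intro filterlim_compose[OF ptw[OF y'(1)]] filterlim_subseq) (simp add: strict_mono_def)
    ultimately show ?thesis using y(2) LIMSEQ_unique by metis
  qed
  have sub: "cball w \<rho> \<subseteq> ball w e" using \<rho>(2) e(1) by (force simp: V_def)
  have "uniform_limit (cball w \<rho>) (\<lambda>k. f ^^ m (t k)) \<psi> sequentially"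
    by (rule unif\<psi>[OF compact_cball sub])
  moreover have "\<psi> u = u" if "u \<in> cball w \<rho>" for u using \<psi>_id \<rho>(2) that by blast
  ultimately have "uniform_limit (cball w \<rho>) (\<lambda>k. f ^^ m (t k)) (\<lambda>z. z) sequentially"
    by (subst (asm) uniform_limit_cong') auto
  then have "uniform_limit (ball w \<rho>) (\<lambda>k. f ^^ m (t k)) (\<lambda>z. z) sequentially"
    by (rule uniform_limit_on_subset) auto
  then show False
    by (rule no_recurrence_to_identity[OF f P w m1 \<rho>(1)])
qed


section \<open>Stability under perturbation\<close>

text \<open>Composition is continuous for locally uniform convergence. The compact set \<open>K\<close> must contain
  a unit neighbourhood of the image of \<open>L\<close> at every step, so that the perturbed orbit does not leave
  the region on which \<open>g\<close> is controlled.\<close>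

lemma iterates_close_on_compact:
  fixes f :: "complex \<Rightarrow> complex"
  assumes f: "f holomorphic_on UNIV" and L: "compact L" and \<eta>: "\<eta> > 0"
  shows "\<exists>K e. compact K \<and> e > 0 \<and> (\<forall>g. (\<forall>z\<in>K. norm (g z - f z) < e) \<longrightarrow>
      (\<forall>z\<in>L. norm ((g ^^ j) z - (f ^^ j) z) < \<eta>))"
  using \<eta>
proof (induction j arbitrary: \<eta>)
  case 0
  then show ?case by (intro exI[of _ "{}"] exI[of _ 1]) auto
next
  case (Suc j)
  show ?case
  proof (cases "L = {}")
    case True
    then show ?thesis by (intro exI[of _ "{}"] exI[of _ 1]) auto
  next
    case False
    define M where "M = {x. infdist x ((f ^^ j) ` L) \<le> 1}"
    have "compact M"
      unfolding M_def
      using False L by (intro compact_infdist_le compact_continuous_image continuous_on_funpow[OF f]) auto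
    then have "uniformly_continuous_on M f"
      by (intro compact_uniformly_continuous continuous_on_subset[OF holomorphic_on_imp_continuous_on[OF f]]) auto
    then obtain d where d: "d > 0" "\<And>x y. x \<in> M \<Longrightarrow> y \<in> M \<Longrightarrow> dist x y < d \<Longrightarrow> dist (f x) (f y) < \<eta> / 2"
      using Suc.prems unfolding uniformly_continuous_on_def by (metis dist_commute half_gt_zero)
    have "min d 1 > 0" using d(1) by simp
    from Suc.IH[OF this] obtain K e where K: "compact K" "e > 0"
      and close: "\<And>g. (\<forall>z\<in>K. norm (g z - f z) < e) \<Longrightarrow>
        \<forall>z\<in>L. norm ((g ^^ j) z - (f ^^ j) z) < min d 1"
      by blast
    show ?thesis
    proof (intro exI conjI allI impI ballI)
      show "compact (M \<union> K)" using \<open>compact M\<close> K(1) by (rule compact_Un)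
      show "min e (\<eta> / 2) > 0" using K(2) Suc.prems by simp
      fix g z assume g: "\<forall>z\<in>M \<union> K. norm (g z - f z) < min e (\<eta> / 2)" and z: "z \<in> L"
      let ?u = "(g ^^ j) z" and ?v = "(f ^^ j) z"
      have "\<forall>z\<in>K. norm (g z - f z) < e" using g by auto
      then have uv: "norm (?u - ?v) < min d 1" using close z by blast
      have "?v \<in> (f ^^ j) ` L" using z by (rule imageI)
      then have "infdist ?u ((f ^^ j) ` L) \<le> dist ?u ?v" "infdist ?v ((f ^^ j) ` L) \<le> dist ?v ?v"
        by (auto intro: infdist_le)
      then have mem: "?u \<in> M" "?v \<in> M" using uv by (auto simp: M_def dist_norm)
      have "norm (g ?u - f ?u) < \<eta> / 2" using g mem(1) by auto
      moreover have "norm (f ?u - f ?v) < \<eta> / 2"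
        using d(2)[OF mem] uv by (simp add: dist_norm)
      ultimately show "norm ((g ^^ Suc j) z - (f ^^ Suc j) z) < \<eta>"
        using norm_triangle_ineq[of "g ?u - f ?u" "f ?u - f ?v"] by simp
    qed
  qed
qed

lemma iterates_close_on_compact_upto:
  fixes f :: "complex \<Rightarrow> complex"
  assumes f: "f holomorphic_on UNIV" and L: "compact L" and \<eta>: "\<eta> > 0"
  obtains K e where "compact K" "e > 0"
    "\<And>g z j. \<lbrakk>\<forall>z\<in>K. norm (g z - f z) < e; z \<in> L; j \<le> N\<rbrakk> \<Longrightarrow>
        norm ((g ^^ j) z - (f ^^ j) z) < \<eta>"
proof -
  obtain K e where K: "\<And>j. compact (K j)" "\<And>j. e j > (0::real)"
    and close: "\<And>j g z. (\<forall>z\<in>K j. norm (g z - f z) < e j) \<Longrightarrow> z \<in> L \<Longrightarrow>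
        norm ((g ^^ j) z - (f ^^ j) z) < \<eta>"
    using iterates_close_on_compact[OF f L \<eta>] by metis
  show ?thesis
  proof (rule that)
    show "compact (\<Union>j\<in>{..N}. K j)" using K(1) by (intro compact_UN) auto
    show "Min (e ` {..N}) > 0" using K(2) by (subst Min_gr_iff) auto
    fix g z j
    assume g: "\<forall>z\<in>(\<Union>j\<in>{..N}. K j). norm (g z - f z) < Min (e ` {..N})"
      and z: "z \<in> L" and j: "j \<le> N"
    have "Min (e ` {..N}) \<le> e j" using j by (intro Min_le) auto
    then have "\<forall>z\<in>K j. norm (g z - f z) < e j"
      using g j by (meson UN_I atMost_iff less_le_trans)
    then show "norm ((g ^^ j) z - (f ^^ j) z) < \<eta>" using z by (rule close)
  qed
qed

text \<open>The closed set \<open>T\<close> absorbs the closure in the definition of the postsingular set, and its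
  neighbourhood \<open>W\<close> is where Montel's theorem applies.\<close>

lemma nonescaping_hyperbolic_if_trapped:
  assumes g: "g \<in> Hol_star" and T: "closed T" and W: "open W" "T \<subseteq> W"
    and B: "\<And>n y. y \<in> W \<Longrightarrow> norm ((g ^^ n) y) \<le> B"
    and orb: "\<And>n s. s \<in> singular_set g \<Longrightarrow> (g ^^ n) s \<in> T"
  shows "nonescaping_hyperbolic g"
proof -
  have holg: "g holomorphic_on UNIV" by (rule Hol_starD(1)[OF g])
  have PT: "postsingular_set g \<subseteq> T"
    unfolding postsingular_set_def using orb T by (intro closure_minimal) auto
  have "norm y \<le> B" if "y \<in> postsingular_set g" for y
    using B[of y 0] that PT W(2) by auto
  then have "bounded (postsingular_set g)" by (auto simp: bounded_iff)
  moreover have "z \<in> Fatou_set g" if z: "z \<in> postsingular_set g" for z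
  proof -
    obtain r where r: "r > 0" "ball z r \<subseteq> W"
      using W z PT open_contains_ball by blast
    have "normal_family (ball z r) (range (\<lambda>n. g ^^ n))"
      unfolding normal_family_def
    proof (intro allI impI)
      fix s :: "nat \<Rightarrow> complex \<Rightarrow> complex" assume s: "range s \<subseteq> range (\<lambda>n. g ^^ n)"
      obtain h q where "h holomorphic_on ball z r" "strict_mono (q :: nat \<Rightarrow> nat)"
        "\<And>x. x \<in> ball z r \<Longrightarrow> (\<lambda>k. s (q k) x) \<longlonglongrightarrow> h x"
        "\<And>K. compact K \<Longrightarrow> K \<subseteq> ball z r \<Longrightarrow> uniform_limit K (s \<circ> q) h sequentially"
      proof (rule Montel[of "ball z r" "range (\<lambda>n. g ^^ n)" s])
        show "h holomorphic_on ball z r" if "h \<in> range (\<lambda>n. g ^^ n)" for h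
          using that holomorphic_funpow[OF holg] by auto
        show "\<exists>C. \<forall>h\<in>range (\<lambda>n. g ^^ n). \<forall>x\<in>K. norm (h x) \<le> C" if "K \<subseteq> ball z r" for K
          using B that r(2) by (intro exI[of _ B]) auto
      qed (use s in auto)
      then show "\<exists>q. strict_mono q \<and>
          ((\<exists>h. h holomorphic_on ball z r \<and>
             (\<forall>K. compact K \<and> K \<subseteq> ball z r \<longrightarrow> uniform_limit K (\<lambda>n. s (q n)) h sequentially)) \<or>
          (\<forall>K. compact K \<and> K \<subseteq> ball z r \<longrightarrow>
             (\<forall>B. \<forall>\<^sub>F n in sequentially. \<forall>z\<in>K. norm (s (q n) z) > B)))"
        unfolding o_def by blast
    qed
    then show ?thesis
      using r(1) unfolding Fatou_set_def by (intro CollectI exI[of _ "ball z r"]) auto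
  qed
  ultimately show ?thesis using g by (auto simp: nonescaping_hyperbolic_def)
qed

lemma contraction_near_compact:
  assumes F: "F holomorphic_on UNIV" and P: "compact P" "P \<noteq> {}"
    and d: "\<And>p. p \<in> P \<Longrightarrow> norm (deriv F p) < 1"
  obtains c e where "0 \<le> c" "c < 1" "e > 0"
    "\<And>p y. p \<in> P \<Longrightarrow> y \<in> ball p e \<Longrightarrow> norm (F y - F p) \<le> c * norm (y - p)"
proof -
  have cont: "continuous_on A (\<lambda>z. norm (deriv F z))" for A
    using holomorphic_on_subset[OF holomorphic_deriv[OF F open_UNIV] subset_UNIV]
    by (intro continuous_on_norm holomorphic_on_imp_continuous_on)
  obtain p0 where p0: "p0 \<in> P" "\<And>p. p \<in> P \<Longrightarrow> norm (deriv F p) \<le> norm (deriv F p0)"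
    using continuous_attains_sup[OF P cont] by blast
  define c where "c = (1 + norm (deriv F p0)) / 2"
  have c: "0 \<le> c" "c < 1" "norm (deriv F p0) < c"
    using d[OF p0(1)] by (auto simp: c_def)
  have "open {z. norm (deriv F z) < c}"
    using cont by (intro open_Collect_less continuous_on_const)
  moreover have "P \<subseteq> {z. norm (deriv F z) < c}" using p0(2) c(3) by force
  ultimately obtain e where e: "e > 0" "(\<Union>p\<in>P. ball p e) \<subseteq> {z. norm (deriv F z) < c}"
    using compact_subset_open_imp_ball_epsilon_subset[OF P(1)] by blast
  show ?thesis
  proof (rule that[OF c(1,2) e(1)])
    fix p y assume p: "p \<in> P" and y: "y \<in> ball p e"
    show "norm (F y - F p) \<le> c * norm (y - p)"
    proof (rule field_differentiable_bound[of "ball p e"])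
      fix z assume z: "z \<in> ball p e"
      show "(F has_field_derivative deriv F z) (at z within ball p e)"
        by (rule has_field_derivative_at_within, rule holomorphic_derivI[OF F open_UNIV]) simp
      have "norm (deriv F z) < c" using e(2) p z by blast
      then show "norm (deriv F z) \<le> c" by simp
    qed (use y e(1) in auto)
  qed
qed

text \<open>Write \<open>T r\<close> for the closed tube of radius \<open>r\<close> around \<open>P\<close>. The iterate \<open>f\<^sup>N\<close> maps
  \<open>T r\<close> into \<open>T (c * r)\<close> with \<open>c < 1\<close>, so an error of size \<open>\<eta> = (1 - c) * d2\<close> still leaves
  every tube with \<open>d2 \<le> r \<le> d\<close> invariant under \<open>g\<^sup>N\<close>. Two tubes are needed: singular values of
  \<open>g\<close> start in the small one, \<open>T d2\<close>, whose iterates under \<open>f\<close> stay in \<open>T (d/4)\<close> by the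
  equi-Lipschitz estimate, so that their orbits under \<open>g\<close> stay in \<open>T (d/2)\<close>, while iterates are
  bounded on the large one, \<open>T d\<close>.\<close>

proposition nonescaping_hyperbolic_stable:
  assumes hyp: "nonescaping_hyperbolic f"
  obtains K e d where "compact K" "e > 0" "d > 0"
    "\<And>g. \<lbrakk>g \<in> Hol_star; \<forall>z\<in>K. norm (g z - f z) < e;
       \<forall>s\<in>singular_set g. \<exists>w\<in>singular_set f. dist s w < d\<rbrakk> \<Longrightarrow> nonescaping_hyperbolic g"
proof -
  define P where "P = postsingular_set f"
  have f: "f \<in> Hol_star" and P_bdd: "bounded P" and P_Fatou: "P \<subseteq> Fatou_set f"
    using hyp by (auto simp: nonescaping_hyperbolic_def P_def)
  have holf: "f holomorphic_on UNIV" by (rule Hol_starD(1)[OF f])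
  have P: "compact P" "f ` P \<subseteq> P" "singular_set f \<subseteq> P" "P \<noteq> {}"
    using postsingular_set_props[OF f] P_bdd by (auto simp: P_def compact_eq_bounded_closed)
  obtain N where N: "\<And>p. p \<in> P \<Longrightarrow> norm (deriv (f ^^ N) p) < 1"
    by (rule iterate_contracts_on_postsingular[OF f P(1,2) P_Fatou P(3)]) (rule that)
  \<comment> \<open>The derivative of the identity is one.\<close>
  have "N \<noteq> 0"
  proof
    assume "N = 0"
    then have "f ^^ N = (\<lambda>z. z)" by (simp add: fun_eq_iff)
    then show False using N P(4) by auto
  qed
  obtain c e1 where c: "0 \<le> c" "c < 1" and e1: "e1 > 0"
    and contr: "\<And>p y. p \<in> P \<Longrightarrow> y \<in> ball p e1 \<Longrightarrow>
      norm ((f ^^ N) y - (f ^^ N) p) \<le> c * norm (y - p)"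
    by (rule contraction_near_compact[OF holomorphic_funpow[OF holf] P(1,4) N], assumption) (rule that)
  obtain e2 B where e2: "e2 > 0" and B: "B \<ge> 1"
    and bd: "\<And>p y n. p \<in> P \<Longrightarrow> y \<in> ball p e2 \<Longrightarrow> norm ((f ^^ n) y) \<le> B"
    and lip: "\<And>p y n. p \<in> P \<Longrightarrow> y \<in> ball p e2 \<Longrightarrow>
        norm ((f ^^ n) y - (f ^^ n) p) \<le> B * norm (y - p)"
    by (rule equi_Lipschitz_near_invariant_Fatou_compact[OF holf P(1,2) P_Fatou]) (rule that)
  define T where "T r = {x. infdist x P \<le> r}" for r
  define d where "d = min e1 e2 / 2"
  define d2 where "d2 = d / (4 * B)"
  define \<eta> where "\<eta> = (1 - c) * d2"
  have d: "d > 0" "d < e1" "d < e2" using e1 e2 by (auto simp: d_def)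
  have d2: "d2 > 0" "B * d2 = d / 4" "d2 \<le> d / 4"
    using d(1) B by (auto simp: d2_def field_simps)
  have \<eta>: "\<eta> > 0" "\<eta> \<le> d2" "\<eta> \<le> (1 - c) * d"
    using c d2 d(1) by (auto simp: \<eta>_def mult_left_le_one_le intro!: mult_left_mono)
  have nearest: "\<exists>p\<in>P. dist x p \<le> r" if "x \<in> T r" for x r
    using infdist_attains_inf[OF compact_imp_closed[OF P(1)] P(4), of x] that
    unfolding T_def by force
  have f_contr: "(f ^^ N) x \<in> T (c * r)" if x: "x \<in> T r" and r: "r \<le> d" for x r
  proof -
    obtain p where p: "p \<in> P" "dist x p \<le> r" using nearest[OF x] by blast
    have "infdist ((f ^^ N) x) P \<le> dist ((f ^^ N) x) ((f ^^ N) p)"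
      by (intro infdist_le funpow_mem[OF P(2) p(1)])
    also have "\<dots> \<le> c * norm (x - p)"
      using contr[OF p(1), of x] p(2) r d(2) by (simp add: dist_norm norm_minus_commute)
    also have "\<dots> \<le> c * r" using p(2) c(1) by (intro mult_left_mono) (auto simp: dist_norm)
    finally show ?thesis by (simp add: T_def)
  qed
  have f_lip: "(f ^^ n) x \<in> T (d / 4)" if x: "x \<in> T d2" for x n
  proof -
    obtain p where p: "p \<in> P" "dist x p \<le> d2" using nearest[OF x] by blast
    have "infdist ((f ^^ n) x) P \<le> dist ((f ^^ n) x) ((f ^^ n) p)"
      by (intro infdist_le funpow_mem[OF P(2) p(1)])
    also have "\<dots> \<le> B * norm (x - p)"
      using lip[OF p(1), of x n] p(2) d2(3) d by (simp add: dist_norm norm_minus_commute)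
    also have "\<dots> \<le> B * d2" using p(2) B by (intro mult_left_mono) (auto simp: dist_norm)
    finally show ?thesis by (simp add: T_def d2(2))
  qed
  have T_mono: "T r \<subseteq> T r'" if "r \<le> r'" for r r' using that by (auto simp: T_def)
  have T_shift: "y \<in> T (r + s)" if "x \<in> T r" "norm (y - x) \<le> s" for x y r s
    using that infdist_triangle[of y P x] by (auto simp: T_def dist_norm)
  have "compact (T d)" unfolding T_def by (rule compact_infdist_le[OF P(4,1) d(1)])
  then obtain K e where K: "compact K" "e > 0"
    and close: "\<And>g z j. \<lbrakk>\<forall>z\<in>K. norm (g z - f z) < e; z \<in> T d; j \<le> N\<rbrakk> \<Longrightarrow>
        norm ((g ^^ j) z - (f ^^ j) z) < \<eta>"
    by (rule iterates_close_on_compact_upto[OF holf _ \<eta>(1), of _ N]) (rule that)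
  show ?thesis
  proof (rule that[OF K d2(1)])
    fix g assume g: "g \<in> Hol_star" and near: "\<forall>z\<in>K. norm (g z - f z) < e"
      and sing: "\<forall>s\<in>singular_set g. \<exists>w\<in>singular_set f. dist s w < d2"
    note close = close[OF near]
    have step: "(g ^^ N) x \<in> T r" if x: "x \<in> T r" and r: "d2 \<le> r" "r \<le> d" for x r
    proof -
      have "x \<in> T d" using x T_mono[OF r(2)] by blast
      then have "norm ((g ^^ N) x - (f ^^ N) x) \<le> \<eta>" using close[of x N] by simp
      then have "(g ^^ N) x \<in> T (c * r + \<eta>)" by (rule T_shift[OF f_contr[OF x r(2)]])
      moreover have "(1 - c) * d2 \<le> (1 - c) * r" using c r by (intro mult_left_mono) auto
      then have "c * r + \<eta> \<le> r" by (simp add: \<eta>_def algebra_simps)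
      ultimately show ?thesis using T_mono by blast
    qed
    \<comment> \<open>Division of \<open>n\<close> by \<open>N\<close> reduces arbitrary iterates to at most \<open>N\<close> steps from a point of the
        same tube, where \<open>g\<close> can be compared with \<open>f\<close>.\<close>
    have split: "\<exists>x'\<in>T r. \<exists>j\<le>N. (g ^^ n) x = (g ^^ j) x'"
      if x: "x \<in> T r" and r: "d2 \<le> r" "r \<le> d" for x r n
    proof (intro bexI exI conjI)
      have "(g ^^ (n mod N + N * (n div N))) x = (g ^^ (n mod N)) ((g ^^ (N * (n div N))) x)"
        by (simp only: funpow_add o_apply)
      then show "(g ^^ n) x = (g ^^ (n mod N)) (((g ^^ N) ^^ (n div N)) x)"
        by (simp add: funpow_mult mult.commute)
      show "n mod N \<le> N" using \<open>N \<noteq> 0\<close> by simp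
      show "((g ^^ N) ^^ (n div N)) x \<in> T r"
        using step[OF _ r] by (intro funpow_mem x) auto
    qed
    show "nonescaping_hyperbolic g"
    proof (rule nonescaping_hyperbolic_if_trapped[OF g, of "T (d / 2)" "{x. infdist x P < d}" "B + \<eta>"])
      show "closed (T (d / 2))"
        unfolding T_def by (intro closed_Collect_le continuous_on_infdist continuous_on_id continuous_on_const)
      show "open {x. infdist x P < d}"
        by (intro open_Collect_less continuous_on_infdist continuous_on_id continuous_on_const)
      show "T (d / 2) \<subseteq> {x. infdist x P < d}" using d(1) by (auto simp: T_def)
    next
      fix n y assume "y \<in> {x. infdist x P < d}"
      then have "y \<in> T d" by (simp add: T_def)
      then obtain x j where x: "x \<in> T d" "j \<le> N" "(g ^^ n) y = (g ^^ j) x"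
        using split[of y d n] d2 d(1) by auto
      obtain p where "p \<in> P" "dist x p \<le> d" using nearest[OF x(1)] by blast
      then have "norm ((f ^^ j) x) \<le> B" using bd[of p x j] d(3) by (simp add: dist_commute)
      moreover have "norm ((g ^^ j) x - (f ^^ j) x) < \<eta>" by (rule close[OF x(1,2)])
      ultimately show "norm ((g ^^ n) y) \<le> B + \<eta>"
        using norm_triangle_ineq2[of "(g ^^ j) x" "(f ^^ j) x"] x(3) by simp
    next
      fix n s assume "s \<in> singular_set g"
      then obtain w where w: "w \<in> singular_set f" "dist s w < d2" using sing by blast
      have "infdist s P \<le> dist s w" using w(1) P(3) by (intro infdist_le) auto
      then have "s \<in> T d2" using w(2) by (simp add: T_def)
      then obtain x j where x: "x \<in> T d2" "j \<le> N" "(g ^^ n) s = (g ^^ j) x"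
        using split[of s d2 n] d2 d(1) by auto
      have "x \<in> T d" using x(1) T_mono[of d2 d] d2 d(1) by auto
      then have "norm ((g ^^ j) x - (f ^^ j) x) \<le> \<eta>" using close[of x j] x(2) by simp
      then have "(g ^^ j) x \<in> T (d / 4 + \<eta>)" by (rule T_shift[OF f_lip[OF x(1)]])
      moreover have "d / 4 + \<eta> \<le> d / 2" using \<eta>(2) d2(3) by simp
      ultimately show "(g ^^ n) s \<in> T (d / 2)" unfolding x(3) using T_mono by blast
    qed
  qed
qed

section \<open>Openness for the dynamical metric\<close>

text \<open>The Cauchy--Schwarz inequality for \<open>(1, \<bar>z\<bar>)\<close> and \<open>(\<bar>w\<bar>, 1)\<close>. It keeps the argument of
  \<open>arcsin\<close> in the range where \<open>arcsin\<close> inverts the sine.\<close>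

lemma spherical_quotient_le_1:
  "norm (z - w :: complex) / (sqrt (1 + (norm z)\<^sup>2) * sqrt (1 + (norm w)\<^sup>2)) \<le> 1"
proof -
  have "(norm (z - w))\<^sup>2 \<le> (norm z + norm w)\<^sup>2"
    by (intro power_mono norm_triangle_ineq4) auto
  also have "\<dots> \<le> (1 + (norm z)\<^sup>2) * (1 + (norm w)\<^sup>2)"
    using zero_le_power2[of "1 - norm z * norm w"] by (simp add: power2_eq_square algebra_simps)
  finally have "norm (z - w) \<le> sqrt ((1 + (norm z)\<^sup>2) * (1 + (norm w)\<^sup>2))"
    by (rule real_le_rsqrt)
  moreover have "sqrt (1 + (norm z)\<^sup>2) * sqrt (1 + (norm w)\<^sup>2) > 0"
    by (intro mult_pos_pos real_sqrt_gt_zero) (simp_all add: add_pos_nonneg)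
  ultimately show ?thesis by (simp add: real_sqrt_mult)
qed

lemma spherical_dist_less_4: "spherical_dist z w < 4"
proof -
  let ?t = "norm (z - w) / (sqrt (1 + (norm z)\<^sup>2) * sqrt (1 + (norm w)\<^sup>2))"
  have "0 \<le> ?t" by simp
  then have "arcsin ?t \<le> pi / 2"
    by (intro arcsin_ubound spherical_quotient_le_1) linarith
  then show ?thesis using pi_less_4 by (simp add: spherical_dist_def)
qed

text \<open>On a bounded set the spherical metric controls the Euclidean one. Only \<open>w\<close> is known to be
  bounded, so the distance itself appears in the conversion factor; for small \<open>e\<close> that term is at
  most half of the left-hand side and can be absorbed.\<close>

lemma spherical_close_imp_dist_less:
  assumes A: "bounded A" and d: "d > 0"
  obtains e where "e > 0" "\<And>w z. w \<in> A \<Longrightarrow> spherical_dist z w < e \<Longrightarrow> dist z w < d"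
proof -
  obtain R where R: "R \<ge> 0" "\<And>w. w \<in> A \<Longrightarrow> norm w \<le> R"
    using A by (metis bounded_pos less_imp_le)
  define e where "e = min (1 / (1 + R)) (d / (1 + R)\<^sup>2)"
  have e: "e > 0" "e * (1 + R) \<le> 1" "e * (1 + R)\<^sup>2 \<le> d"
    using R(1) d by (auto simp: e_def min_def field_simps)
  show ?thesis
  proof (rule that[OF e(1)])
    fix w z assume w: "w \<in> A" and zw: "spherical_dist z w < e"
    let ?a = "sqrt (1 + (norm z)\<^sup>2)" and ?b = "sqrt (1 + (norm w)\<^sup>2)"
    define t where "t = norm (z - w) / (?a * ?b)"
    have ab: "?a > 0" "?b > 0" by (simp_all add: add_pos_nonneg)
    have t: "0 \<le> t" "t \<le> 1"
      using spherical_quotient_le_1[of z w] by (auto simp: t_def)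
    have "t = sin (arcsin t)" using t by simp
    also have "\<dots> \<le> arcsin t"
      using t arcsin_le_arcsin[of 0 t] by (intro sin_x_le_x) auto
    also have "\<dots> < e / 2" using zw by (simp add: spherical_dist_def t_def)
    finally have "norm (z - w) < e / 2 * (?a * ?b)"
      using ab by (simp add: t_def field_simps)
    also have "\<dots> \<le> e / 2 * ((1 + R + norm (z - w)) * (1 + R))"
    proof (intro mult_left_mono mult_mono)
      have "?a \<le> 1 + norm z" by (rule real_le_lsqrt) (auto simp: power2_eq_square algebra_simps)
      also have "norm z \<le> R + norm (z - w)"
        using R(2)[OF w] norm_triangle_ineq2[of z w] by simp
      finally show "?a \<le> 1 + R + norm (z - w)" by simp
      have "?b \<le> 1 + norm w" by (rule real_le_lsqrt) (auto simp: power2_eq_square algebra_simps)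
      then show "?b \<le> 1 + R" using R(2)[OF w] by simp
    qed (use e(1) R(1) ab in auto)
    also have "\<dots> = e * (1 + R)\<^sup>2 / 2 + (e * (1 + R)) * norm (z - w) / 2"
      by (simp add: power2_eq_square algebra_simps add_divide_distrib)
    also have "\<dots> \<le> d / 2 + 1 * norm (z - w) / 2"
      using e(2,3) by (intro add_mono divide_right_mono mult_right_mono) auto
    finally show "dist z w < d" by (simp add: dist_norm)
  qed
qed

lemma hausdorff_dist_less:
  assumes ne: "A \<noteq> {}" "B \<noteq> {}"
  shows "0 \<le> hausdorff_dist A B"
    and "hausdorff_dist A B < e \<Longrightarrow> B \<subseteq> spherical_nbhd e A"
proof -
  let ?X = "{\<epsilon>. \<epsilon> > 0 \<and> A \<subseteq> spherical_nbhd \<epsilon> B \<and> B \<subseteq> spherical_nbhd \<epsilon> A}"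
  have "4 \<in> ?X" using ne spherical_dist_less_4 by (auto simp: spherical_nbhd_def)
  then have X: "?X \<noteq> {}" by blast
  show "0 \<le> hausdorff_dist A B"
    unfolding hausdorff_dist_def by (rule cInf_greatest[OF X]) auto
  assume "hausdorff_dist A B < e"
  then obtain e' where "e' \<in> ?X" "e' < e"
    unfolding hausdorff_dist_def using cInf_lessD[OF X] by blast
  then show "B \<subseteq> spherical_nbhd e A" by (force simp: spherical_nbhd_def)
qed

text \<open>The set of entire \<open>g\<close> with \<open>sup\<^sub>K \<bar>g - f\<bar> < e\<close> is open in \<^const>\<open>luc_topology\<close>, hence
  contains a metric ball. Phrasing the supremum by a bound \<open>b < e\<close> gives the room \<open>e - b\<close> that
  openness requires.\<close>

lemma locally_uniform_metric_close:
  assumes chi: "locally_uniform_metric chi" and f: "f \<in> entire" and K: "compact K" and e: "e > 0"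
  obtains d where "d > 0" "\<And>g z. \<lbrakk>g \<in> entire; chi f g < d; z \<in> K\<rbrakk> \<Longrightarrow> norm (g z - f z) < e"
proof -
  interpret Metric_space entire chi
    using chi by (simp add: locally_uniform_metric_def)
  let ?U = "{g \<in> entire. \<exists>b<e. \<forall>z\<in>K. dist (g z) (f z) \<le> b}"
  have "openin luc_topology ?U"
    unfolding openin_luc_topology
  proof (intro conjI ballI)
    fix g assume "g \<in> ?U"
    then obtain b where b: "b < e" "\<And>z. z \<in> K \<Longrightarrow> dist (g z) (f z) \<le> b" by blast
    have "{h \<in> entire. \<forall>z\<in>K. dist (h z) (g z) < (e - b) / 2} \<subseteq> ?U"
    proof (intro subsetI CollectI conjI exI ballI)
      fix h z assume h: "h \<in> {h \<in> entire. \<forall>z\<in>K. dist (h z) (g z) < (e - b) / 2}" and z: "z \<in> K"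
      then have "dist (h z) (g z) < (e - b) / 2" by blast
      then show "dist (h z) (f z) \<le> (e + b) / 2"
        using b(2)[OF z] dist_triangle[of "h z" "f z" "g z"] by (simp add: field_simps)
    qed (use b(1) in auto)
    then show "\<exists>K \<epsilon>. compact K \<and> 0 < \<epsilon> \<and> {h \<in> entire. \<forall>z\<in>K. dist (h z) (g z) < \<epsilon>} \<subseteq> ?U"
      using K b(1) by (intro exI[of _ K] exI[of _ "(e - b) / 2"]) auto
  qed auto
  then have "openin mtopology ?U" using chi by (simp add: locally_uniform_metric_def)
  moreover have "f \<in> ?U" using f e by (auto intro: exI[of _ 0])
  ultimately obtain d where d: "d > 0" "mball f d \<subseteq> ?U"
    unfolding openin_mtopology by blast
  show ?thesis
  proof (rule that[OF d(1)])
    fix g z assume "g \<in> entire" "chi f g < d" and z: "z \<in> K"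
    then have "g \<in> ?U" using d(2) f by (auto simp: in_mball)
    then show "norm (g z - f z) < e" using z by (force simp: dist_norm)
  qed
qed

theorem nonescaping_hyperbolic_open_chi_dyn:
  assumes chi: "locally_uniform_metric chi" and f: "f \<in> Hol_star_b" and hyp: "nonescaping_hyperbolic f"
  obtains \<epsilon> where "\<epsilon> > 0"
    "\<And>g. \<lbrakk>g \<in> Hol_star_b; chi_dyn chi f g < \<epsilon>\<rbrakk> \<Longrightarrow> nonescaping_hyperbolic g"
proof -
  obtain K e d where K: "compact K" "e > 0" "d > 0"
    and stable: "\<And>g. \<lbrakk>g \<in> Hol_star; \<forall>z\<in>K. norm (g z - f z) < e;
       \<forall>s\<in>singular_set g. \<exists>w\<in>singular_set f. dist s w < d\<rbrakk> \<Longrightarrow> nonescaping_hyperbolic g"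
    by (rule nonescaping_hyperbolic_stable[OF hyp]) (rule that)
  have fH: "f \<in> Hol_star" "bounded (singular_set f)" "f \<in> entire"
    using f by (auto simp: Hol_star_b_def Hol_star_def)
  obtain e1 where e1: "e1 > 0"
    "\<And>g z. \<lbrakk>g \<in> entire; chi f g < e1; z \<in> K\<rbrakk> \<Longrightarrow> norm (g z - f z) < e"
    by (rule locally_uniform_metric_close[OF chi fH(3) K(1,2)]) (rule that)
  obtain e2 where e2: "e2 > 0"
    "\<And>w z. w \<in> singular_set f \<Longrightarrow> spherical_dist z w < e2 \<Longrightarrow> dist z w < d"
    by (rule spherical_close_imp_dist_less[OF fH(2) K(3)]) (rule that)
  interpret Metric_space entire chi
    using chi by (simp add: locally_uniform_metric_def)
  show ?thesis
  proof (rule that[of "min e1 e2"])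
    fix g assume g: "g \<in> Hol_star_b" and less: "chi_dyn chi f g < min e1 e2"
    have gH: "g \<in> Hol_star" "g \<in> entire" using g by (auto simp: Hol_star_b_def Hol_star_def)
    note ne = singular_set_nonempty[OF fH(1)] singular_set_nonempty[OF gH(1)]
    have "chi f g < e1" "hausdorff_dist (singular_set f) (singular_set g) < e2"
      using less hausdorff_dist_less(1)[OF ne] nonneg[of f g] unfolding chi_dyn_def by linarith+
    moreover from this have "singular_set g \<subseteq> spherical_nbhd e2 (singular_set f)"
      by (intro hausdorff_dist_less(2)[OF ne])
    then have "\<forall>s\<in>singular_set g. \<exists>w\<in>singular_set f. dist s w < d"
      using e2(2) unfolding spherical_nbhd_def by blast
    ultimately show "nonescaping_hyperbolic g"
      using e1(2)[OF gH(2)] by (intro stable gH) auto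
  qed (use e1 e2 in auto)
qed


section \<open>Kernels of hyperbolic components\<close>

text \<open>Chart images are open in a linear subspace, where small balls are convex and thus connected.\<close>

lemma complex_atlas_imp_locally_connected:
  fixes \<A> :: "('m::topological_space set \<times> ('m \<Rightarrow> complex^'d::finite)) set"
  assumes "complex_atlas I \<A>"
  shows "locally connected (UNIV :: 'm set)"
proof (rule locally_connected_1)
  fix V :: "'m set" and x
  assume "openin (top_of_set UNIV) V" and x: "x \<in> V"
  then have V: "open V" by simp
  let ?M = "model_space I :: (complex^'d) set"
  have convM: "convex ?M"
    by (intro convexI) (simp add: model_space_def)
  obtain U \<phi> where U: "(U, \<phi>) \<in> \<A>" "x \<in> U"
    using assms by (force simp: complex_atlas_def)
  obtain \<psi> where opU: "open U" and op\<phi>U: "openin (top_of_set ?M) (\<phi> ` U)"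
    and hom: "homeomorphism U (\<phi> ` U) \<phi> \<psi>"
    using assms U(1) unfolding complex_atlas_def by blast
  have "openin (top_of_set U) (U \<inter> V)" using V by (rule openin_open_Int)
  from openin_trans[OF homeomorphism_imp_open_map[OF hom this] op\<phi>U]
  have "openin (top_of_set ?M) (\<phi> ` (U \<inter> V))" .
  then obtain e where e: "e > 0" "ball (\<phi> x) e \<inter> ?M \<subseteq> \<phi> ` (U \<inter> V)"
    using U(2) x unfolding openin_contains_ball by blast
  define W where "W = ball (\<phi> x) e \<inter> ?M"
  have W: "W \<subseteq> \<phi> ` (U \<inter> V)" "\<phi> x \<in> W"
    using e op\<phi>U U(2) by (auto simp: W_def dest: openin_imp_subset)
  have "connected W"
    unfolding W_def by (intro convex_connected convex_Int convex_ball convM)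
  moreover have "continuous_on W \<psi>"
    using hom W(1) by (auto simp: homeomorphism_def intro: continuous_on_subset)
  ultimately have "connected (\<psi> ` W)" by (intro connected_continuous_image)
  moreover have "openin (top_of_set (\<phi> ` U)) W"
    using openin_subset_trans[of ?M W "\<phi> ` U"] W(1) openin_imp_subset[OF op\<phi>U]
    by (auto simp: W_def Int_commute)
  then have "openin (top_of_set U) (\<psi> ` W)"
    by (rule homeomorphism_imp_open_map[OF homeomorphism_symD[OF hom]])
  then have "open (\<psi> ` W)" using opU openin_open_eq by blast
  moreover have "x \<in> \<psi> ` W"
    using W(2) homeomorphism_apply1[OF hom U(2)] by force
  moreover have "\<psi> ` W \<subseteq> V"
    using W(1) homeomorphism_apply1[OF hom] by fastforce
  ultimately show "\<exists>u. openin (top_of_set UNIV) u \<and> connected u \<and> x \<in> u \<and> u \<subseteq> V" by auto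
qed

lemma eventually_contains_compact:
  fixes Os :: "nat \<Rightarrow> 'm::metric_space set"
  assumes K: "compact K"
    and loc: "\<And>x. x \<in> K \<Longrightarrow> \<exists>U. open U \<and> x \<in> U \<and> (\<forall>\<^sub>F n in sequentially. U \<inter> K \<subseteq> Os n)"
  shows "\<forall>\<^sub>F n in sequentially. K \<subseteq> Os n"
proof -
  obtain U where U: "\<And>x. x \<in> K \<Longrightarrow> open (U x)" "\<And>x. x \<in> K \<Longrightarrow> x \<in> U x"
    "\<And>x. x \<in> K \<Longrightarrow> \<forall>\<^sub>F n in sequentially. U x \<inter> K \<subseteq> Os n"
    using loc by metis
  obtain D where D: "D \<subseteq> K" "finite D" "K \<subseteq> (\<Union>x\<in>D. U x)"
    using compactE_image[OF K, of K U] U(1,2) by blast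
  have "\<forall>\<^sub>F n in sequentially. \<forall>x\<in>D. U x \<inter> K \<subseteq> Os n"
    using D(1,2) U(3) by (intro eventually_ball_finite) auto
  then show ?thesis by eventually_elim (use D(3) in blast)
qed

text \<open>The kernel is the union of all candidates, once there is one: a compact subset of the union
  splits into finitely many compact pieces, each inside a single candidate.\<close>

lemma kernel_exists:
  fixes Os :: "nat \<Rightarrow> 'm::metric_space set"
  assumes Os: "\<And>n. open (Os n)" "\<And>n. connected (Os n)" "\<And>n. p \<in> Os n"
    and W0: "kernel_candidate Os p W0"
  shows "is_kernel Os p (\<Union>{W. kernel_candidate Os p W})"
proof -
  let ?U = "\<Union>{W. kernel_candidate Os p W}"
  have "\<forall>\<^sub>F n in sequentially. K \<subseteq> Os n" if K: "compact K" "K \<subseteq> ?U" for K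
  proof (rule eventually_contains_compact[OF K(1)])
    fix x assume "x \<in> K"
    then obtain W where W: "kernel_candidate Os p W" "x \<in> W" using K(2) by blast
    then have "open W" by (simp add: kernel_candidate_def)
    then obtain r where r: "r > 0" "cball x r \<subseteq> W" using W(2) open_contains_cball by blast
    have "compact (K \<inter> cball x r)" using K(1) by (simp add: compact_Int_closed)
    then have "\<forall>\<^sub>F n in sequentially. K \<inter> cball x r \<subseteq> Os n"
      using W(1) r(2) unfolding kernel_candidate_def by blast
    then have "\<forall>\<^sub>F n in sequentially. ball x r \<inter> K \<subseteq> Os n"
      by eventually_elim (use ball_subset_cball in blast)
    then show "\<exists>U. open U \<and> x \<in> U \<and> (\<forall>\<^sub>F n in sequentially. U \<inter> K \<subseteq> Os n)"
      using r(1) by (intro exI[of _ "ball x r"]) auto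
  qed
  moreover have "open ?U" by (rule open_Union) (simp add: kernel_candidate_def)
  moreover have "connected ?U"
    by (rule connected_Union[of _]) (auto simp: kernel_candidate_def)
  moreover have "p \<in> ?U" using W0 by (auto simp: kernel_candidate_def)
  ultimately have "kernel_candidate Os p ?U" unfolding kernel_candidate_def[of _ _ ?U] by blast
  then show ?thesis using Os by (auto simp: is_kernel_def)
qed

text \<open>Every point of \<open>C0\<close> has a connected neighbourhood that lies in \<open>H n\<close> for large \<open>n\<close>. Such a
  neighbourhood is contained in the component \<open>C n\<close> as soon as it meets it. So the relation of being
  eventually swallowed by \<open>C n\<close> propagates from \<open>p\<close> through the connected set \<open>C0\<close>, and compact
  subsets of \<open>C0\<close> are handled by finitely many neighbourhoods.\<close>

lemma component_in_kernel_of_components: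
  fixes H :: "nat \<Rightarrow> 'm::metric_space set"
  assumes lc: "locally connected (UNIV :: 'm set)"
    and H: "\<And>n. open (H n)" and C0: "open C0" "connected C0" "C0 \<noteq> {}"
    and stable: "\<And>l. l \<in> C0 \<Longrightarrow> \<exists>U N. open U \<and> l \<in> U \<and> (\<forall>n\<ge>N. U \<subseteq> H n)"
  shows "\<exists>C N p W. (\<forall>n\<ge>N. C n \<in> components (H n)) \<and> is_kernel (\<lambda>n. C (N + n)) p W \<and> C0 \<subseteq> W"
proof -
  obtain p where p: "p \<in> C0" using C0(3) by blast
  define C where "C n = connected_component_set (H n) p" for n
  obtain N where N: "\<And>n. n \<ge> N \<Longrightarrow> p \<in> H n" using stable[OF p] by blast
  have comp: "C n \<in> components (H n)" if "n \<ge> N" for n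
    using N[OF that] by (auto simp: components_def C_def)
  have pC: "p \<in> C n" if "n \<ge> N" for n using N[OF that] by (simp add: C_def)
  have opC: "open (C n)" if "n \<ge> N" for n
    using lc H[of n] N[OF that] by (auto simp: C_def locally_connected_open_connected_component)
  have swallow: "U \<subseteq> C n" if "connected U" "U \<subseteq> H n" "y \<in> U" "y \<in> C n" for U n y
    using that unfolding C_def
    by (metis connected_component_eq connected_component_maximal)
  \<comment> \<open>A tame set that meets a good one is good. Hence the good sets and the remaining tame sets
      have disjoint open unions, which cover \<open>C0\<close>.\<close>
  define good where "good U \<longleftrightarrow> open U \<and> (\<exists>N. \<forall>n\<ge>N. U \<subseteq> C n)" for U
  define tame where "tame U \<longleftrightarrow> open U \<and> connected U \<and> (\<exists>N. \<forall>n\<ge>N. U \<subseteq> H n)" for U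
  have tame: "\<exists>U. tame U \<and> x \<in> U" if x: "x \<in> C0" for x
  proof -
    obtain V M where V: "open V" "x \<in> V" "\<And>n. n \<ge> M \<Longrightarrow> V \<subseteq> H n"
      using stable[OF x] by blast
    then obtain U where "open U" "connected U" "x \<in> U" "U \<subseteq> V"
      using lc unfolding locally_connected by (metis open_openin subtopology_UNIV)
    then show ?thesis using V(3) unfolding tame_def by blast
  qed
  have good: "good U" if U: "tame U" "good V" "y \<in> U" "y \<in> V" for U V y
  proof -
    obtain N1 N2 where "\<forall>n\<ge>N1. U \<subseteq> H n" "\<forall>n\<ge>N2. V \<subseteq> C n"
      using U(1,2) by (auto simp: tame_def good_def)
    note N12 = this
    have "connected U" using U(1) by (simp add: tame_def)
    have "\<forall>n\<ge>max N1 N2. U \<subseteq> C n"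
    proof (intro allI impI)
      fix n assume n: "max N1 N2 \<le> n"
      have "U \<subseteq> H n" using N12(1) n by simp
      moreover have "V \<subseteq> C n" using N12(2) n by simp
      then have "y \<in> C n" using U(4) by (rule subsetD)
      ultimately show "U \<subseteq> C n" by (rule swallow[OF \<open>connected U\<close> _ U(3)])
    qed
    then show ?thesis using U(1) unfolding good_def tame_def by blast
  qed
  have "\<Union>{U. good U} \<inter> C0 = {} \<or> \<Union>{U. tame U \<and> \<not> good U} \<inter> C0 = {}"
  proof (rule connectedD[OF C0(2)])
    show "open (\<Union>{U. good U})" by (rule open_Union) (simp add: good_def)
    show "open (\<Union>{U. tame U \<and> \<not> good U})" by (rule open_Union) (simp add: tame_def)
    show "\<Union>{U. good U} \<inter> \<Union>{U. tame U \<and> \<not> good U} \<inter> C0 = {}" using good by blast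
    show "C0 \<subseteq> \<Union>{U. good U} \<union> \<Union>{U. tame U \<and> \<not> good U}" using tame by blast
  qed
  moreover have "p \<in> \<Union>{U. good U}"
  proof -
    obtain U where U: "tame U" "p \<in> U" using tame[OF p] by blast
    then obtain M where "\<forall>n\<ge>M. U \<subseteq> H n" by (auto simp: tame_def)
    note M = this
    have "connected U" using U(1) by (simp add: tame_def)
    have "\<forall>n\<ge>max M N. U \<subseteq> C n"
    proof (intro allI impI)
      fix n assume n: "max M N \<le> n"
      have "U \<subseteq> H n" using M n by simp
      moreover have "p \<in> C n" using pC[of n] n by simp
      ultimately show "U \<subseteq> C n" by (rule swallow[OF \<open>connected U\<close> _ U(2)])
    qed
    then show ?thesis using U unfolding good_def tame_def by blast
  qed
  ultimately have C0_good: "\<exists>U. good U \<and> x \<in> U" if "x \<in> C0" for x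
    using tame[OF that] that p by blast
  have "\<forall>\<^sub>F n in sequentially. K \<subseteq> C (N + n)" if K: "compact K" "K \<subseteq> C0" for K
  proof (rule eventually_contains_compact[OF K(1)])
    fix x assume "x \<in> K"
    then have "x \<in> C0" using K(2) by (rule rev_subsetD)
    from C0_good[OF this] obtain U M where U: "open U" "x \<in> U" "\<forall>n\<ge>M. U \<subseteq> C n"
      unfolding good_def by blast
    have "\<forall>\<^sub>F n in sequentially. U \<inter> K \<subseteq> C (N + n)"
      using eventually_ge_at_top[of M]
    proof eventually_elim
      case (elim n)
      then have "U \<subseteq> C (N + n)" using U(3) by simp
      then show ?case by blast
    qed
    then show "\<exists>U. open U \<and> x \<in> U \<and> (\<forall>\<^sub>F n in sequentially. U \<inter> K \<subseteq> C (N + n))"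
      using U(1,2) by blast
  qed
  then have cand: "kernel_candidate (\<lambda>n. C (N + n)) p C0"
    using C0(1,2) p by (simp add: kernel_candidate_def)
  have "is_kernel (\<lambda>n. C (N + n)) p (\<Union>{W. kernel_candidate (\<lambda>n. C (N + n)) p W})"
  proof (rule kernel_exists[OF _ _ _ cand])
    show "open (C (N + n))" "p \<in> C (N + n)" for n
      using opC pC by simp_all
    show "connected (C (N + n))" for n
      by (simp add: C_def)
  qed
  with comp cand show ?thesis by blast
qed

text \<open>The continuity hypothesis is used at the points \<open>(n, l)\<close> with fixed \<open>n\<close>, which makes each
  hyperbolic locus open, and at the points \<open>(\<infinity>, l)\<close>, which compares \<open>f \<infinity>\<close> with \<open>f n\<close> for large
  \<open>n\<close>.\<close>

theorem proposition3p1: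
  fixes I :: "'d::finite set"
    and \<A> :: "('m::metric_space set \<times> ('m \<Rightarrow> complex^'d)) set"
    and chi_luc :: "(complex \<Rightarrow> complex) \<Rightarrow> (complex \<Rightarrow> complex) \<Rightarrow> real"
    and f :: "enat \<Rightarrow> 'm \<Rightarrow> complex \<Rightarrow> complex"
    and H_inf :: "'m set"
  assumes "complex_atlas I \<A>"
    and "locally_uniform_metric chi_luc"
    and "\<And>n l. f n l \<in> Hol_star_b"
    and "\<forall>p. \<forall>\<epsilon>>0. \<exists>\<delta>>0. \<forall>q. chi_prod p q < \<delta> \<longrightarrow>
           chi_dyn chi_luc (f (fst p) (snd p)) (f (fst q) (snd q)) < \<epsilon>"
    and "H_inf \<in> components (hyperbolic_locus (f \<infinity>))"
  shows "\<exists>(C :: nat \<Rightarrow> 'm set) N p H.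
           (\<forall>n\<ge>N. C n \<in> components (hyperbolic_locus (f (enat n)))) \<and>
           is_kernel (\<lambda>n. C (N + n)) p H \<and> H_inf \<subseteq> H"
proof -
  have nbhd: "\<exists>\<delta>>0. \<forall>k \<nu>. chi_enat n k + dist l \<nu> < \<delta> \<longrightarrow> \<nu> \<in> hyperbolic_locus (f k)"
    if l: "l \<in> hyperbolic_locus (f n)" for n l
  proof -
    have "nonescaping_hyperbolic (f n l)" using l by (simp add: hyperbolic_locus_def)
    then obtain \<epsilon> where \<epsilon>: "\<epsilon> > 0"
      "\<And>g. \<lbrakk>g \<in> Hol_star_b; chi_dyn chi_luc (f n l) g < \<epsilon>\<rbrakk> \<Longrightarrow> nonescaping_hyperbolic g"
      by (rule nonescaping_hyperbolic_open_chi_dyn[OF assms(2,3)]) (rule that)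
    obtain \<delta> where "\<delta> > 0" "\<And>q. chi_prod (n, l) q < \<delta> \<Longrightarrow>
        chi_dyn chi_luc (f n l) (f (fst q) (snd q)) < \<epsilon>"
      using assms(4)[rule_format, OF \<epsilon>(1), of "(n, l)"] by auto
    then have "\<forall>k \<nu>. chi_enat n k + dist l \<nu> < \<delta> \<longrightarrow> \<nu> \<in> hyperbolic_locus (f k)"
      using \<epsilon>(2)[OF assms(3)] by (fastforce simp: chi_prod_def hyperbolic_locus_def)
    with \<open>\<delta> > 0\<close> show ?thesis by blast
  qed
  have opn: "open (hyperbolic_locus (f n))" for n
    unfolding open_contains_ball
  proof
    fix l assume "l \<in> hyperbolic_locus (f n)"
    from nbhd[OF this] obtain \<delta> where "\<delta> > 0"
      "\<And>k \<nu>. chi_enat n k + dist l \<nu> < \<delta> \<Longrightarrow> \<nu> \<in> hyperbolic_locus (f k)" by blast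
    then show "\<exists>e>0. ball l e \<subseteq> hyperbolic_locus (f n)"
      by (intro exI[of _ \<delta>]) (auto simp: chi_enat_def)
  qed
  have stable: "\<exists>U N. open U \<and> l \<in> U \<and> (\<forall>n\<ge>N. U \<subseteq> hyperbolic_locus (f (enat n)))"
    if "l \<in> hyperbolic_locus (f \<infinity>)" for l
  proof -
    from nbhd[OF that] obtain \<delta> where \<delta>: "\<delta> > 0"
      "\<And>k \<nu>. chi_enat \<infinity> k + dist l \<nu> < \<delta> \<Longrightarrow> \<nu> \<in> hyperbolic_locus (f k)" by blast
    obtain N where N: "(1/2) ^ N < \<delta>"
      using real_arch_pow_inv[OF \<delta>(1), of "1/2"] by auto
    have "chi_enat \<infinity> (enat n) \<le> (1/2) ^ N / 2" if "n \<ge> N" for n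
    proof -
      have "(1/2 :: real) ^ n \<le> (1/2) ^ N" using that by (intro power_decreasing) auto
      then show ?thesis by (simp add: chi_enat_def power_divide)
    qed
    then have "ball l (\<delta> / 2) \<subseteq> hyperbolic_locus (f (enat n))" if "n \<ge> N" for n
      using \<delta>(2)[of "enat n"] N that by fastforce
    then show ?thesis using \<delta>(1) by (intro exI[of _ "ball l (\<delta> / 2)"] exI[of _ N]) auto
  qed
  have lc: "locally connected (UNIV :: 'm set)"
    by (rule complex_atlas_imp_locally_connected[OF assms(1)])
  have sub: "H_inf \<subseteq> hyperbolic_locus (f \<infinity>)" by (rule in_components_subset[OF assms(5)])
  have "locally connected (hyperbolic_locus (f \<infinity>))"
    using lc opn by (auto intro: locally_open_subset)
  then have "openin (top_of_set (hyperbolic_locus (f \<infinity>))) H_inf"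
    by (rule openin_components_locally_connected[OF _ assms(5)])
  then have "open H_inf" by (rule openin_open_trans[OF _ opn])
  then show ?thesis
    using sub in_components_connected[OF assms(5)] in_components_nonempty[OF assms(5)] stable
    by (intro component_in_kernel_of_components[OF lc opn]) auto
qed

end
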